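(* Assume that: (1) for each $i\in\mathcal I$, $J_i$ is continuously differentiable and convex in $x_i$ for given $x_{-i}$; the set $\mathcal X$ satisfies Slater's condition; and $G$ has full row rank; (2) the pseudo-gradient $F$ is $\mu$-strongly monotone and $\theta$-Lipschitz continuous on $\mathbb R^n$ ($\mu,\theta>0$); (3) the communication graph $\mathcal G$ is undirected and connected. Consider the closed-loop system $$\dot\zeta^{r-1}=\tilde u^{r-1},\qquad \tilde u^{r-1}=-F(\zeta^{r-1})-G_d^\top\lambda,\qquad \dot z=L\lambda,$$ $$\lambda=\operatorname*{arg\,min}_{\lambda\ge0}\ \tfrac12\|G_d^\top\lambda\|^2+\lambda^\top\big[G_dF(\zeta^{r-1})-\alpha_r(G_d\zeta^{r-1}-H_s)+Lz\big]+\tfrac12\lambda^\top L\lambda,$$ $$\dot x_i^d=A^dx_i^d+B^d\tilde u_i^{r-1},\qquad x_i=\zeta_i^{r-1}-\Delta_ix_i^d,\qquad i\in\mathcal I .$$ For any feasible initial condition $x(0)\in\mathcal X$, the following hold: (i) the variable $\zeta^{r-1}$ converges asymptotically to the v-GNE of the game in the coordinates $\zeta^{r-1}$ with constraint set $\mathcal Z_{r-1}$, with $\mathcal Z_{r-1}$ being forward invariant, provided $\alpha_r>\frac{\theta^2}{4\mu}$; (ii) the dynamics of $x^d=\mathrm{col}\{x_i^d\}_{i\in\mathcal I}$ is input-to-state stable (ISS) with respect to the input $\tilde u^{r-1}$, provided $\alpha_k>0$ for all $k\in\{1,\dots,r-1\}$. Hence the closed-loop system solves the original game for the v-GNE (i.e.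 $x(t)$ converges asymptotically to the v-GNE of the original game), with forward invariance of the constraint set $\mathcal X$ (i.e. $x(t)\in\mathcal X$ for all $t\ge0$).
   Context: Game. There are $N$ players indexed by $\mathcal I=\{1,\dots,N\}$. Player $i$ chooses $x_i\in\mathbb R^{n_i}$; $n=\sum_i n_i$; $x=\mathrm{col}\{x_i\}_{i\in\mathcal I}\in\mathbb R^n$ is the stacked vector and $x_{-i}$ the stacked vector of the decisions of all players other than $i$. Player $i$ has objective $J_i(x_i,x_{-i})$, and local constraint data $g_i\in\mathbb R^{m\times n_i}$, $h_i\in\mathbb R^m$. Put $G=[g_1\ \cdots\ g_N]$, $H=\sum_i h_i$, $\mathcal X=\{x\in\mathbb R^n\mid Gx-H\le 0\}$, $G_d=\mathrm{diag}\{g_i\}_{i\in\mathcal I}$ (block diagonal), $H_s=\mathrm{col}\{h_i\}_{i\in\mathcal I}$. Inequalities between vectors are entrywise. The (original) game is: for each $i$, $\min_{x_i} J_i(x_i,x_{-i})$ subject to $(x_i,x_{-i})\in\mathcal X$. A GNE is $x^*$ such that, for all $i$, $x_i^*$ minimizes $J_i(x_i,x_{-i}^* )$ over $x_i$ with $(x_i,x_{-i}^* )\in\mathcal X$. Pseudo-gradient: $F(x)=\mathrm{col}\{\nabla_{x_i}J_i(x_i,x_{-i})\}_{i\in\mathcal I}$. $\mu$-strongly monotone: $(F(x)-F(y))^\top(x-y)\ge\mu\|x-y\|^2$ for all $x,y$. $\theta$-Lipschitz: $\|F(x)-F(y)\|\le\theta\|x-y\|$ for all $x,y$. v-GNE (variational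 GNE): a GNE that is a solution of VI$(\mathcal X,F)$, i.e. $x^*\in\mathcal X$ with $(x-x^* )^\top F(x^* )\ge0$ for all $x\in\mathcal X$; equivalently, the KKT conditions $\nabla_{x_i}J_i(x_i^*,x_{-i}^* )+g_i^\top\lambda_i^*=0$, $0\le\lambda_i^*\perp(H-Gx^* )\ge0$ hold for all $i$ with identical multipliers $\lambda_i^*=\underline\lambda\in\mathbb R^m_+$. Communication graph: $\mathcal G$ is an undirected weighted graph on $\mathcal I$ with symmetric adjacency matrix $\mathcal A=[a_{ij}]$, $a_{ij}\ge0$, $a_{ii}=0$, $a_{ij}>0$ iff $(i,j)$ is an edge; Laplacian $\mathcal L=\mathrm{diag}\{\mathcal A\mathbf 1_N\}-\mathcal A$; $L=\mathcal L\otimes I_m$. The variables $z=\mathrm{col}\{z_i\}$, $\lambda=\mathrm{col}\{\lambda_i\}$ have $z_i,\lambda_i\in\mathbb R^m$. Multi-integrator agents: $x_i^{(r)}=u_i$, $r\in\mathbb N_+$, where $x_i^{(k)}$ is the $k$-th time derivative of $x_i\in\mathbb R^{n_i}$ and $u_i\in\mathbb R^{n_i}$ is the input. Let $\alpha_1,\dots,\alpha_r>0$ be parameters. Let $\delta^1,\dots,\delta^{r-1}$ be the coefficients, other than the leading one, of $\prod_{\ell=1}^{r-1}(s+\frac1{\alpha_\ell})=s^{r-1}+\delta^1s^{r-2}+\cdots+\delta^{r-1}$. Define $\zeta_i^{r-1}=x_i+\sum_{j=1}^{r-1}\delta^jx_i^{(j)}$, $\zeta^{r-1}=\mathrm{col}\{\zeta_i^{r-1}\}$,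 and $\tilde u_i^{r-1}=\dot\zeta_i^{r-1}=x_i^{(1)}+\sum_{j=1}^{r-2}\delta^jx_i^{(j+1)}+\delta^{r-1}u_i$, $\tilde u^{r-1}=\mathrm{col}\{\tilde u_i^{r-1}\}$. Let $x_i^d=\mathrm{col}\{x_i^{(1)},\dots,x_i^{(r-1)}\}$, $\Delta_i=[\delta^1I_{n_i}\ \cdots\ \delta^{r-1}I_{n_i}]$, $B^d=[0\ \cdots\ 0\ \frac1{\delta^{r-1}}I_{n_i}]^\top$, and let $A^d$ be the block companion matrix whose first $r-2$ block rows are the block shift (identity blocks $I_{n_i}$ on the block superdiagonal, zeros elsewhere) and whose last block row is $[-\frac1{\delta^{r-1}}I_{n_i}\ -\frac{\delta^1}{\delta^{r-1}}I_{n_i}\ \cdots\ -\frac{\delta^{r-2}}{\delta^{r-1}}I_{n_i}]$. When $r=1$, $\zeta^0=x$ and the $x^d$-subsystem is absent. Transformed game: $\mathcal Z_{r-1}=\{\zeta^{r-1}\in\mathbb R^n\mid G\zeta^{r-1}\le H\}$; a GNE in the new coordinates is $(\zeta^{r-1})^*$ such that for all $i$, $(\zeta_i^{r-1})^*$ minimizes $J_i(\zeta_i^{r-1},(\zeta_{-i}^{r-1})^* )$ subject to $(\zeta_i^{r-1},(\zeta_{-i}^{r-1})^* )\in\mathcal Z_{r-1}$ and $x_i^{(k)}=0$ for all $k\in\{1,\dots,r-1\}$; the v-GNE is the one solving VI$(\mathcal Z_{r-1},F)$. Forward invariance of $\mathcal Z_{r-1}$ means $\zeta^{r-1}(0)\in\mathcal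 Z_{r-1}$ implies $\zeta^{r-1}(t)\in\mathcal Z_{r-1}$ for all $t\ge0$.
   Formalization: For r ≥ 2, forward invariance of X is shown only if, besides x(0) ∈ X, all intermediate coordinates ζ^k(0), k = 1,…,r−1 (formed with α_1,…,α_k), lie in X; with x(0) ∈ X alone it fails (x(0) on the boundary, outward initial velocity). *)

theory Defs
  imports
    "HOL-Analysis.Analysis"
    "HOL-Computational_Algebra.Polynomial"
begin

text \<open>
  Conventions. Players are the elements of a finite type \<open>'i\<close>, constraints the elements of a finite
  type \<open>'m\<close>. The space of stacked decisions is \<open>real ^ 'n\<close>, whose coordinates are distributed
  among the players by \<open>own :: 'n \<Rightarrow> 'i\<close>: the block \<open>x\<^sub>i\<close> consists of the coordinates \<open>c\<close> with
  \<open>own c = i\<close>, so that \<open>n\<^sub>i = card {c. own c = i}\<close> may differ from player to player. Likewise \<open>g\<^sub>i\<close>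
  consists of the columns \<open>c\<close> of \<open>G\<close> with \<open>own c = i\<close>. Stacked vectors with one block in
  \<open>real ^ 'm\<close> per player live in \<open>real ^ ('i \<times> 'm)\<close>. The order \<open>\<le>\<close> on vectors is the entrywise one.
\<close>


section \<open>The game\<close>

text \<open>The vector \<open>(y\<^sub>i, x\<^sub>-\<^sub>i)\<close>.\<close>

definition replace :: "('n::finite \<Rightarrow> 'i) \<Rightarrow> 'i \<Rightarrow> real ^ 'n \<Rightarrow> real ^ 'n \<Rightarrow> real ^ 'n" where
  "replace own i y x = (\<chi> c. if own c = i then y $ c else x $ c)"

text \<open>
  As a function of \<open>y\<close>, \<open>f (replace own i y x)\<close> depends on the block \<open>y\<^sub>i\<close> only. Its gradient is
  therefore \<open>\<nabla>\<^sub>i f(y\<^sub>i, x\<^sub>-\<^sub>i)\<close> on the coordinates of player \<open>i\<close>, and zero on all others.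
\<close>

definition block_gradient ::
    "('n::finite \<Rightarrow> 'i) \<Rightarrow> 'i \<Rightarrow> (real ^ 'n \<Rightarrow> real) \<Rightarrow> real ^ 'n \<Rightarrow> real ^ 'n" where
  "block_gradient own i f x = (THE D. GDERIV (\<lambda>y. f (replace own i y x)) x :> D)"

definition pseudo_gradient ::
    "('n::finite \<Rightarrow> 'i) \<Rightarrow> ('i \<Rightarrow> real ^ 'n \<Rightarrow> real) \<Rightarrow> real ^ 'n \<Rightarrow> real ^ 'n" where
  "pseudo_gradient own J x = (\<chi> c. block_gradient own (own c) (J (own c)) x $ c)"

definition continuously_differentiable :: "(real ^ 'n \<Rightarrow> real) \<Rightarrow> bool" where
  "continuously_differentiable f \<longleftrightarrow>
     (\<exists>f'. (\<forall>y. GDERIV f y :> f' y) \<and> continuous_on UNIV f')"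

definition feasible_set :: "real ^ 'n ^ 'm \<Rightarrow> real ^ 'm \<Rightarrow> (real ^ 'n) set" where
  "feasible_set G H = {x. G *v x - H \<le> 0}"

text \<open>Strictness in Slater's condition is entrywise; \<open><\<close> on vectors would be weaker.\<close>

definition slater :: "real ^ 'n ^ 'm \<Rightarrow> real ^ 'm \<Rightarrow> bool" where
  "slater G H \<longleftrightarrow> (\<exists>x. \<forall>k. (G *v x - H) $ k < 0)"

definition GNE ::
    "('n::finite \<Rightarrow> 'i) \<Rightarrow> ('i \<Rightarrow> real ^ 'n \<Rightarrow> real) \<Rightarrow> (real ^ 'n) set \<Rightarrow> real ^ 'n \<Rightarrow> bool" where
  "GNE own J X x \<longleftrightarrow>
     (\<forall>i. is_arg_min (\<lambda>y. J i (replace own i y x)) (\<lambda>y. replace own i y x \<in> X) x)"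

definition VI_solution ::
    "(real ^ 'n) set \<Rightarrow> (real ^ 'n \<Rightarrow> real ^ 'n) \<Rightarrow> real ^ 'n \<Rightarrow> bool" where
  "VI_solution X F x \<longleftrightarrow> x \<in> X \<and> (\<forall>y\<in>X. 0 \<le> (y - x) \<bullet> F x)"

definition v_GNE ::
    "('n::finite \<Rightarrow> 'i) \<Rightarrow> ('i \<Rightarrow> real ^ 'n \<Rightarrow> real) \<Rightarrow> (real ^ 'n) set \<Rightarrow> real ^ 'n \<Rightarrow> bool" where
  "v_GNE own J X x \<longleftrightarrow> GNE own J X x \<and> VI_solution X (pseudo_gradient own J) x"

definition strongly_monotone :: "real \<Rightarrow> (real ^ 'n \<Rightarrow> real ^ 'n) \<Rightarrow> bool" where
  "strongly_monotone \<mu> F \<longleftrightarrow> (\<forall>x y. \<mu> * (norm (x - y))\<^sup>2 \<le> (F x - F y) \<bullet> (x - y))"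


section \<open>The game in the transformed coordinates\<close>

text \<open>
  For \<open>q = r - 1\<close>, player \<open>i\<close> decides on \<open>\<zeta>\<^sub>i\<close> and on the derivatives \<open>d 1, \<dots>, d q\<close> of its
  position, subject to the shared constraint on \<open>\<zeta>\<close> and to these derivatives being zero.
\<close>

definition transformed_set :: "real ^ 'n ^ 'm \<Rightarrow> real ^ 'm \<Rightarrow> (real ^ 'n) set" where
  "transformed_set G H = {\<zeta>. G *v \<zeta> \<le> H}"

definition transformed_GNE ::
    "('n::finite \<Rightarrow> 'i) \<Rightarrow> ('i \<Rightarrow> real ^ 'n \<Rightarrow> real) \<Rightarrow> (real ^ 'n) set \<Rightarrow> nat \<Rightarrow> real ^ 'n \<Rightarrow> bool" where
  "transformed_GNE own J Z q \<zeta> \<longleftrightarrow>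
     (\<exists>d :: nat \<Rightarrow> real ^ 'n. \<forall>i.
        is_arg_min
          (\<lambda>(y, e). J i (replace own i y \<zeta>))
          (\<lambda>(y, e). replace own i y \<zeta> \<in> Z \<and> (\<forall>k\<in>{1..q}. \<forall>c. own c = i \<longrightarrow> e k $ c = 0))
          (\<zeta>, d))"

definition transformed_v_GNE ::
    "('n::finite \<Rightarrow> 'i) \<Rightarrow> ('i \<Rightarrow> real ^ 'n \<Rightarrow> real) \<Rightarrow> (real ^ 'n) set \<Rightarrow> nat \<Rightarrow> real ^ 'n \<Rightarrow> bool" where
  "transformed_v_GNE own J Z q \<zeta> \<longleftrightarrow>
     transformed_GNE own J Z q \<zeta> \<and> VI_solution Z (pseudo_gradient own J) \<zeta>"


section \<open>Communication graph and stacked constraint data\<close>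

definition undirected_weighted_graph :: "real ^ 'i ^ 'i \<Rightarrow> bool" where
  "undirected_weighted_graph A \<longleftrightarrow>
     (\<forall>i j. A $ i $ j = A $ j $ i) \<and> (\<forall>i j. 0 \<le> A $ i $ j) \<and> (\<forall>i. A $ i $ i = 0)"

definition connected_graph :: "real ^ 'i ^ 'i \<Rightarrow> bool" where
  "connected_graph A \<longleftrightarrow> (\<forall>i j. (i, j) \<in> {(a, b). 0 < A $ a $ b}\<^sup>*)"

definition laplacian :: "real ^ 'i ^ 'i \<Rightarrow> real ^ 'i ^ 'i" where
  "laplacian A = (\<chi> i j. if i = j then \<Sum>l\<in>UNIV. A $ i $ l else 0) - A"

text \<open>The Kronecker product of \<open>M\<close> with the identity matrix indexed by \<open>'m\<close>.\<close>

definition kron_id ::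
    "real ^ 'i::finite ^ 'i \<Rightarrow> real ^ ('i \<times> 'm::finite) ^ ('i \<times> 'm)" where
  "kron_id M = (\<chi> p q. if snd p = snd q then M $ fst p $ fst q else 0)"

text \<open>The block diagonal matrix \<open>diag {g\<^sub>i}\<close>.\<close>

definition block_diag ::
    "('n::finite \<Rightarrow> 'i::finite) \<Rightarrow> real ^ 'n ^ 'm::finite \<Rightarrow> real ^ 'n ^ ('i \<times> 'm)" where
  "block_diag own G = (\<chi> p c. if own c = fst p then G $ snd p $ c else 0)"

definition stack :: "('i::finite \<Rightarrow> real ^ 'm::finite) \<Rightarrow> real ^ ('i \<times> 'm)" where
  "stack h = (\<chi> p. h (fst p) $ snd p)"


section \<open>The seeking law\<close>

definition multiplier_cost ::
    "real ^ 'n ^ 'p \<Rightarrow> real ^ 'p ^ 'p \<Rightarrow> real ^ 'p \<Rightarrow> real \<Rightarrow> (real ^ 'n \<Rightarrow> real ^ 'n) \<Rightarrow>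
     real ^ 'n \<Rightarrow> real ^ 'p \<Rightarrow> real ^ 'p \<Rightarrow> real" where
  "multiplier_cost Gd L Hs a F \<zeta> z l =
     1/2 * (norm (transpose Gd *v l))\<^sup>2
     + l \<bullet> (Gd *v F \<zeta> - a *\<^sub>R (Gd *v \<zeta> - Hs) + L *v z)
     + 1/2 * (l \<bullet> (L *v l))"

text \<open>
  \<open>delta \<alpha> q j\<close> is the coefficient of \<open>s^(q - j)\<close> in \<open>\<Prod>l=1..q. (s + 1 / \<alpha> l)\<close>; in particular
  \<open>delta \<alpha> q 0 = 1\<close>. The coefficients \<open>\<delta>\<^sup>j\<close> of a multi-integrator of order \<open>r\<close> are
  \<open>delta \<alpha> (r - 1) j\<close>.
\<close>

definition delta :: "(nat \<Rightarrow> real) \<Rightarrow> nat \<Rightarrow> nat \<Rightarrow> real" where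
  "delta \<alpha> q j = coeff (\<Prod>l\<in>{1..q}. [:1 / \<alpha> l, 1:]) (q - j)"

text \<open>
  The intermediate coordinates \<open>\<zeta>\<^sup>k = x + \<Sum>j=1..k. \<delta>\<^sup>j x\<^sup>(\<^sup>j\<^sup>)\<close>, with the \<open>\<delta>\<^sup>j\<close> formed from
  \<open>\<alpha> 1, \<dots>, \<alpha> k\<close>; \<open>d j\<close> stands for the \<open>j\<close>-th derivative of \<open>x\<close>.
  The derivative of \<open>\<zeta>\<^sup>k\<close> is \<open>\<alpha> (k+1) (\<zeta>\<^sup>k\<^sup>+\<^sup>1 - \<zeta>\<^sup>k)\<close>. An initial position in the constraint set does not
  stop \<open>x\<close> from leaving it if the initial velocity points outwards. Feasibility of the initial state,
  as needed for the invariance of the set under \<open>x\<close>, is therefore feasibility of all \<open>\<zeta>\<^sup>k\<close> at time 0.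
\<close>

definition zeta_coord ::
    "(nat \<Rightarrow> real) \<Rightarrow> nat \<Rightarrow> real ^ 'n \<Rightarrow> (nat \<Rightarrow> real ^ 'n) \<Rightarrow> real ^ 'n" where
  "zeta_coord \<alpha> k x d = x + (\<Sum>j\<in>{1..k}. delta \<alpha> k j *\<^sub>R d j)"

text \<open>
  All blocks of \<open>A\<^sup>d\<close> and \<open>B\<^sup>d\<close> are multiples of the identity, with factors (for \<open>q = r - 1\<close> and
  \<open>k, j \<in> {1..q}\<close>) \<open>companion \<alpha> q k j\<close> and \<open>input_gain \<alpha> q k\<close>. So the subsystems of all players
  can be written at once, \<open>d j\<close> being the stack over the players of the \<open>j\<close>-th block of \<open>x\<^sub>i\<^sup>d\<close>.
\<close>

definition companion :: "(nat \<Rightarrow> real) \<Rightarrow> nat \<Rightarrow> nat \<Rightarrow> nat \<Rightarrow> real" where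
  "companion \<alpha> q k j =
     (if k < q then (if j = Suc k then 1 else 0) else - (delta \<alpha> q (j - 1) / delta \<alpha> q q))"

definition input_gain :: "(nat \<Rightarrow> real) \<Rightarrow> nat \<Rightarrow> nat \<Rightarrow> real" where
  "input_gain \<alpha> q k = (if k = q then 1 / delta \<alpha> q q else 0)"

definition derivative_field ::
    "(nat \<Rightarrow> real) \<Rightarrow> nat \<Rightarrow> nat \<Rightarrow> (nat \<Rightarrow> real ^ 'n) \<Rightarrow> real ^ 'n \<Rightarrow> real ^ 'n" where
  "derivative_field \<alpha> q k d u =
     (\<Sum>j\<in>{1..q}. companion \<alpha> q k j *\<^sub>R d j) + input_gain \<alpha> q k *\<^sub>R u"


section \<open>Input-to-state stability\<close>

definition class_K :: "(real \<Rightarrow> real) \<Rightarrow> bool" where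
  "class_K \<gamma> \<longleftrightarrow> continuous_on {0..} \<gamma> \<and> strict_mono_on {0..} \<gamma> \<and> \<gamma> 0 = 0"

definition class_KL :: "(real \<Rightarrow> real \<Rightarrow> real) \<Rightarrow> bool" where
  "class_KL \<beta> \<longleftrightarrow>
     continuous_on ({0..} \<times> {0..}) (\<lambda>(s, t). \<beta> s t) \<and>
     (\<forall>t\<ge>0. class_K (\<lambda>s. \<beta> s t)) \<and>
     (\<forall>s\<ge>0. antimono_on {0..} (\<beta> s) \<and> (\<beta> s \<longlongrightarrow> 0) at_top)"

text \<open>
  The state consists of the blocks \<open>x k\<close> with \<open>k\<close> in the finite set \<open>K\<close>, and its norm is the
  Euclidean norm of the stacked vector. Inputs are measurable and bounded on \<open>{0..T}\<close>; solutions
  are those of the integrated equation (Caratheodory solutions). The estimate is demanded for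
  solutions on arbitrary intervals \<open>{0..T}\<close>, so it also covers solutions that are not known in
  advance to exist for all times.
\<close>

definition ISS ::
    "nat set \<Rightarrow> (nat \<Rightarrow> (nat \<Rightarrow> 'a::euclidean_space) \<Rightarrow> 'b::euclidean_space \<Rightarrow> 'a) \<Rightarrow> bool" where
  "ISS K f \<longleftrightarrow>
     (\<exists>\<beta> \<gamma>. class_KL \<beta> \<and> class_K \<gamma> \<and>
        (\<forall>T\<ge>0. \<forall>u :: real \<Rightarrow> 'b. \<forall>x :: nat \<Rightarrow> real \<Rightarrow> 'a.
           set_borel_measurable lebesgue {0..T} u \<longrightarrow>
           bounded (u ` {0..T}) \<longrightarrow>
           (\<forall>k\<in>K. \<forall>t\<in>{0..T}.
              ((\<lambda>s. f k (\<lambda>j. x j s) (u s)) has_integral (x k t - x k 0)) {0..t}) \<longrightarrow>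
           L2_set (\<lambda>k. norm (x k T)) K
             \<le> \<beta> (L2_set (\<lambda>k. norm (x k 0)) K) T + \<gamma> (SUP s\<in>{0..T}. norm (u s))))"

end

theory Submission
  imports Defs
begin

text \<open>
  The multipliers enter only through the variational inequality satisfied by the minimiser over the
  orthant. Testing it with the multiplier increased by the same vector for all players removes the
  Laplacian terms and gives \<open>d/dt (G \<zeta> - H) \<le> - \<alpha>\<^sub>r (G \<zeta> - H)\<close>, hence invariance. Testing it with an
  equilibrium multiplier \<open>\<lambda>'\<close> shows that \<open>V = \<alpha>\<^sub>r/2 |\<zeta> - \<zeta>'|\<^sup>2 + 1/2 |z - z'|\<^sup>2\<close> decreases at least at
  the rate \<open>c (|e|\<^sup>2 + |P|\<^sup>2)\<close>, with \<open>e = \<zeta> - \<zeta>'\<close> and \<open>P\<close> the image of \<open>\<lambda> - \<lambda>'\<close> under the transpose of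
  \<open>G\<^sub>d\<close>: the condition \<open>\<alpha>\<^sub>r > \<theta>\<^sup>2 / (4 \<mu>)\<close> says that the quadratic form
  \<open>\<alpha>\<^sub>r \<mu> |e|\<^sup>2 - \<theta> |e| |P| + |P|\<^sup>2\<close> is positive definite. As \<open>|e|\<^sup>2\<close> grows at most at the rate
  \<open>|e|\<^sup>2 + |P|\<^sup>2\<close>, this forces \<open>e \<longlonglongrightarrow> 0\<close> without a bound on the multipliers or Barbalat's lemma.

  The coordinates \<open>\<zeta>\<^sup>0 = x, \<dots>, \<zeta>\<^sup>r\<^sup>-\<^sup>1 = \<zeta>\<close> form a chain of first-order lags
  \<open>d/dt \<zeta>\<^sup>k = \<alpha>\<^sub>k\<^sub>+\<^sub>1 (\<zeta>\<^sup>k\<^sup>+\<^sup>1 - \<zeta>\<^sup>k)\<close>, and so do their derivatives, with last input \<open>u\<close>. Convergence,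
  invariance and input-to-state stability pass down such a chain, one lag at a time.
\<close>


section \<open>Comparison and first-order lags\<close>

text \<open>If \<open>g\<close> were positive at \<open>t\<close>, the last earlier time
  \<open>s\<close> with \<open>g s \<le> 0\<close> would have \<open>g s = 0\<close> and
  \<open>g\<close> nonnegative on \<open>{s..t}\<close>, so \<open>step\<close> forces
  \<open>g t \<le> 0\<close>.\<close>

lemma nonpos_of_decreasing_while_nonneg:
  fixes g :: "real \<Rightarrow> real"
  assumes cont: "continuous_on {a..b} g" and init: "g a \<le> 0"
    and step: "\<And>s t. a \<le> s \<Longrightarrow> s \<le> t \<Longrightarrow> t \<le> b \<Longrightarrow> (\<And>\<tau>. \<tau> \<in> {s..t} \<Longrightarrow> 0 \<le> g \<tau>) \<Longrightarrow> g t \<le> g s"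
    and t: "t \<in> {a..b}"
  shows "g t \<le> 0"
proof (rule ccontr)
  assume "\<not> g t \<le> 0"
  then have pos: "0 < g t" by simp
  have cont_t: "continuous_on {a..t} g"
    using cont t by (auto intro: continuous_on_subset)
  define S where "S = {s \<in> {a..t}. g s \<le> 0}"
  have "closed S"
    unfolding S_def by (intro continuous_on_closed_Collect_le continuous_intros cont_t)
  then have "compact S"
    unfolding S_def by (metis (no_types, lifting) S_def bounded_closed_interval bounded_subset
        compact_eq_bounded_closed mem_Collect_eq subsetI)
  moreover have "a \<in> S" using init t by (auto simp: S_def)
  ultimately obtain s where s: "s \<in> S" and max: "\<And>y. y \<in> S \<Longrightarrow> y \<le> s"
    using compact_attains_sup[of S] by blast
  have "continuous_on {s..t} g"
    using cont_t s by (auto simp: S_def intro: continuous_on_subset)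
  then obtain s0 where "s \<le> s0" "s0 \<le> t" "g s0 = 0"
    using IVT'[of g s 0 t] s pos by (auto simp: S_def)
  then have "s0 \<in> S" using s by (auto simp: S_def)
  then have gs: "g s = 0" using max[of s0] \<open>s \<le> s0\<close> \<open>g s0 = 0\<close> by simp
  have "0 \<le> g \<tau>" if "\<tau> \<in> {s..t}" for \<tau>
  proof (rule ccontr)
    assume neg: "\<not> 0 \<le> g \<tau>"
    then have "\<tau> \<in> S" using that s by (auto simp: S_def)
    then have "\<tau> = s" using max[of \<tau>] that by simp
    then show False using neg gs by simp
  qed
  then have "g t \<le> g s" using s t by (intro step) (auto simp: S_def)
  then show False using gs pos by simp
qed

text \<open>The rate \<open>g'\<close> is tied to \<open>g\<close> through its integral only and
  need not be a pointwise derivative, as befits integral solutions with measurable inputs.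
  Continuity of \<open>g\<close> comes from the indefinite integral.\<close>

lemma nonpos_of_integral:
  fixes g g' :: "real \<Rightarrow> real"
  assumes int: "\<And>t. t \<in> {a..b} \<Longrightarrow> (g' has_integral (g t - g a)) {a..t}"
    and init: "g a \<le> 0"
    and step: "\<And>t. t \<in> {a..b} \<Longrightarrow> 0 \<le> g t \<Longrightarrow> g' t \<le> 0"
    and t: "t \<in> {a..b}"
  shows "g t \<le> 0"
proof (rule nonpos_of_decreasing_while_nonneg[where g = g and a = a and b = b])
  have "g' integrable_on {a..b}" using int[of b] t by (auto simp: has_integral_integrable)
  then have "continuous_on {a..b} (\<lambda>s. g a + integral {a..s} g')"
    by (intro continuous_intros indefinite_integral_continuous_1)
  moreover have "g a + integral {a..s} g' = g s" if "s \<in> {a..b}" for s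
    using integral_unique[OF int[OF that]] by simp
  ultimately show "continuous_on {a..b} g"
    by (metis (no_types, lifting) continuous_on_cong)
next
  fix s t assume st: "a \<le> s" "s \<le> t" "t \<le> b" and nn: "\<And>\<tau>. \<tau> \<in> {s..t} \<Longrightarrow> 0 \<le> g \<tau>"
  have "g' integrable_on {a..t}" using int[of t] st by auto
  then have "g' integrable_on {s..t}"
    using st by (auto intro: integrable_subinterval_real)
  then obtain i where i: "(g' has_integral i) {s..t}" by (auto simp: integrable_on_def)
  have "(g' has_integral (g s - g a + i)) {a..t}"
    using has_integral_combine[OF st(1,2) int i] st by auto
  then have "g s - g a + i = g t - g a"
    using int[of t] st by (intro has_integral_unique[of g' _ "{a..t}"]) auto
  moreover have "i \<le> 0"
    using has_integral_le[OF i has_integral_0] step nn st by auto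
  ultimately show "g t \<le> g s" by simp
qed (use init t in auto)

lemma has_vector_derivative_integral_0:
  fixes g :: "real \<Rightarrow> 'a::banach"
  assumes "\<And>t. 0 \<le> t \<Longrightarrow> (g has_vector_derivative g' t) (at t within {0..})" and "0 \<le> s" "s \<le> t"
  shows "(g' has_integral (g t - g s)) {s..t}"
  using assms(2)
  by (intro fundamental_theorem_of_calculus[OF assms(3)]
      has_vector_derivative_within_subset[OF assms(1)]) auto

lemma nonpos_of_derivative:
  fixes g g' :: "real \<Rightarrow> real"
  assumes "\<And>t. 0 \<le> t \<Longrightarrow> (g has_vector_derivative g' t) (at t within {0..})"
    and "g 0 \<le> 0" and "\<And>t. 0 \<le> t \<Longrightarrow> 0 \<le> g t \<Longrightarrow> g' t \<le> 0" and "0 \<le> t"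
  shows "g t \<le> 0"
proof (rule nonpos_of_integral[where g = g and g' = g' and a = 0 and b = t])
  fix s assume "s \<in> {0..t}"
  then show "(g' has_integral (g s - g 0)) {0..s}"
    by (intro has_vector_derivative_integral_0[OF assms(1)]) auto
qed (use assms(2-4) in auto)

text \<open>The majorant \<open>m s = M * exp (- c * s) + B\<close> is a supersolution of the scalar
  lag once \<open>\<kappa> * A \<le> (\<kappa> - c) * M\<close>, and \<open>M\<close> is chosen for
  that. The condition \<open>c < \<kappa>\<close> excludes resonance.\<close>

lemma lag_bound:
  fixes y v :: "real \<Rightarrow> 'a::euclidean_space"
  assumes int: "\<And>t. t \<in> {0..T} \<Longrightarrow> ((\<lambda>s. \<kappa> *\<^sub>R (v s - y s)) has_integral (y t - y 0)) {0..t}"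
    and c: "0 < c" "c < \<kappa>" and nn: "0 \<le> A" "0 \<le> B" "0 \<le> Y"
    and v: "\<And>s. s \<in> {0..T} \<Longrightarrow> norm (v s) \<le> A * exp (- c * s) + B"
    and y0: "norm (y 0) \<le> Y"
    and t: "t \<in> {0..T}"
  shows "norm (y t) \<le> (Y + \<kappa> / (\<kappa> - c) * A) * exp (- c * t) + B"
proof -
  define M where "M = Y + \<kappa> / (\<kappa> - c) * A"
  \<comment> \<open>A direction fixed at the final time: \<open>y s \<bullet> b\<close> satisfies a
    scalar lag equation, and it equals \<open>norm (y s)\<close> at \<open>s = t\<close>. The norm
    itself is never differentiated.\<close>
  define b where "b = sgn (y t)"
  have M: "\<kappa> * A \<le> (\<kappa> - c) * M" "Y \<le> M"
    using c nn by (auto simp: M_def distrib_left)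
  have b1: "norm b \<le> 1" by (simp add: b_def norm_sgn)
  have yb: "y t \<bullet> b = norm (y t)"
    by (cases "y t = 0") (auto simp: b_def sgn_div_norm dot_square_norm power2_eq_square)
  have ub: "w \<bullet> b \<le> norm w" for w
    by (metis b1 mult.right_neutral mult_left_mono norm_cauchy_schwarz norm_ge_zero order_trans)
  define m where "m s = M * exp (- c * s) + B" for s
  define g where "g s = y s \<bullet> b - m s" for s
  define g' where "g' s = \<kappa> * (v s \<bullet> b - y s \<bullet> b) + c * (M * exp (- c * s))" for s
  have "g t \<le> 0"
  proof (rule nonpos_of_integral[where g = g and g' = g' and a = 0 and b = T])
    fix s assume s: "s \<in> {0..T}"
    have "((\<lambda>s. \<kappa> *\<^sub>R (v s - y s) \<bullet> b) has_integral ((y s - y 0) \<bullet> b)) {0..s}"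
      using has_integral_linear[OF int[OF s] bounded_linear_inner_left[of b]] by (simp add: o_def)
    moreover have "((\<lambda>s. - (c * (M * exp (- c * s)))) has_integral (m s - m 0)) {0..s}"
      using s unfolding m_def
      by (intro fundamental_theorem_of_calculus)
        (auto intro!: derivative_eq_intros simp flip: has_real_derivative_iff_has_vector_derivative)
    ultimately have "((\<lambda>s. \<kappa> *\<^sub>R (v s - y s) \<bullet> b - - (c * (M * exp (- c * s))))
        has_integral ((y s - y 0) \<bullet> b - (m s - m 0))) {0..s}"
      by (rule has_integral_diff)
    then show "(g' has_integral (g s - g 0)) {0..s}"
      by (simp add: g'_def[abs_def] g_def inner_diff_left algebra_simps)
    assume "0 \<le> g s"
    then have "m s \<le> y s \<bullet> b" by (simp add: g_def)
    moreover have "v s \<bullet> b \<le> A * exp (- c * s) + B" using ub[of "v s"] v[OF s] by simp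
    ultimately have "v s \<bullet> b - y s \<bullet> b \<le> (A - M) * exp (- c * s)"
      by (simp add: m_def algebra_simps)
    then have "g' s \<le> \<kappa> * ((A - M) * exp (- c * s)) + c * (M * exp (- c * s))"
      unfolding g'_def using c by (intro add_right_mono mult_left_mono) auto
    also have "\<dots> = (\<kappa> * A - (\<kappa> - c) * M) * exp (- c * s)" by (simp add: algebra_simps)
    also have "\<dots> \<le> 0" using M(1) by (simp add: mult_nonpos_nonneg)
    finally show "g' s \<le> 0" .
  next
    show "g 0 \<le> 0" using ub[of "y 0"] y0 M(2) nn by (simp add: g_def m_def)
  qed (rule t)
  then show ?thesis by (simp add: g_def m_def M_def yb)
qed

text \<open>The distance of the input from \<open>p\<close> is at most a decaying exponential plus
  \<open>e / 2\<close>: the exponential covers a compact initial interval, the constant covers the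
  rest. \<open>lag_bound\<close> passes this on to the output with the same constant.\<close>

lemma lag_tendsto:
  fixes w v :: "real \<Rightarrow> 'a::euclidean_space"
  assumes der: "\<And>t. 0 \<le> t \<Longrightarrow> (w has_vector_derivative \<kappa> *\<^sub>R (v t - w t)) (at t within {0..})"
    and \<kappa>: "0 < \<kappa>" and cont: "continuous_on {0..} v" and v: "(v \<longlongrightarrow> p) at_top"
  shows "(w \<longlongrightarrow> p) at_top"
proof (rule tendstoI)
  fix e :: real assume e: "0 < e"
  define c where "c = \<kappa> / 2"
  have c: "0 < c" "c < \<kappa>" using \<kappa> by (auto simp: c_def)
  have "\<forall>\<^sub>F s in at_top. dist (v s) p < e / 2" using v e by (intro tendstoD) auto
  then obtain T0 where T0: "\<And>s. T0 \<le> s \<Longrightarrow> dist (v s) p < e / 2"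
    by (auto simp: eventually_at_top_linorder)
  have "compact ((\<lambda>s. v s - p) ` {0..max 0 T0})"
    by (intro compact_continuous_image continuous_intros continuous_on_subset[OF cont]) auto
  then obtain K where K: "\<And>s. s \<in> {0..max 0 T0} \<Longrightarrow> norm (v s - p) \<le> K"
    by (meson bounded_iff compact_imp_bounded imageI)
  have K0: "0 \<le> K" using K[of 0] by (meson atLeastAtMost_iff max.cobounded1 norm_ge_zero order.refl order_trans)
  define A where "A = K * exp (c * max 0 T0)"
  have A0: "0 \<le> A" using K0 by (simp add: A_def)
  have vb: "norm (v s - p) \<le> A * exp (- c * s) + e / 2" if "0 \<le> s" for s
  proof (cases "s \<le> max 0 T0")
    case True
    have "K \<le> K * exp (c * (max 0 T0 - s))"
      using True c K0 mult_left_mono[of 1 "exp (c * (max 0 T0 - s))" K] by simp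
    also have "\<dots> = A * exp (- c * s)"
      by (simp add: A_def right_diff_distrib flip: exp_add)
    finally show ?thesis using K[of s] True that e by auto
  next
    case False
    then have "norm (v s - p) < e / 2" using T0[of s] by (simp add: dist_norm)
    then show ?thesis using A0 by (smt (verit) exp_ge_zero mult_nonneg_nonneg)
  qed
  define M where "M = norm (w 0 - p) + \<kappa> / (\<kappa> - c) * A"
  have wb: "norm (w t - p) \<le> M * exp (- c * t) + e / 2" if "0 \<le> t" for t
    unfolding M_def
  proof (rule lag_bound[where T = t and v = "\<lambda>s. v s - p"])
    fix s assume s: "s \<in> {0..t}"
    show "((\<lambda>s. \<kappa> *\<^sub>R ((v s - p) - (w s - p))) has_integral ((w s - p) - (w 0 - p))) {0..s}"
      using has_vector_derivative_integral_0[OF der, of 0 s] s by simp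
  qed (use c A0 e vb that in auto)
  have "((\<lambda>t. M * exp (- c * t)) \<longlongrightarrow> M * 0) at_top"
    using c
    by (intro tendsto_mult tendsto_const filterlim_compose[OF exp_at_bot]
        filterlim_tendsto_neg_mult_at_bot[OF tendsto_const _ filterlim_ident]) auto
  then have "\<forall>\<^sub>F t in at_top. dist (M * exp (- c * t)) 0 < e / 2"
    using e by (intro tendstoD) auto
  then show "\<forall>\<^sub>F t in at_top. dist (w t) p < e"
    using eventually_ge_at_top[of 0]
  proof eventually_elim
    case (elim t)
    then show ?case using wb[of t] by (auto simp: dist_norm)
  qed
qed

text \<open>Induction from the input \<open>y q\<close> down the chain. Each lag has static gain
  one, so \<open>U\<close> passes unchanged, while the transient coefficient goes from
  \<open>A\<close> to at most \<open>S + \<rho> * A\<close>; this builds up the geometric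
  sum.\<close>

lemma cascade_bound:
  fixes y :: "nat \<Rightarrow> real \<Rightarrow> 'a::euclidean_space" and \<kappa> :: "nat \<Rightarrow> real"
  assumes int: "\<And>k t. k < q \<Longrightarrow> t \<in> {0..T} \<Longrightarrow>
      ((\<lambda>s. \<kappa> k *\<^sub>R (y (Suc k) s - y k s)) has_integral (y k t - y k 0)) {0..t}"
    and c: "0 < c" "\<And>k. k < q \<Longrightarrow> c < \<kappa> k" and nn: "0 \<le> S" "0 \<le> U"
    and \<rho>: "\<And>k. k < q \<Longrightarrow> \<kappa> k / (\<kappa> k - c) \<le> \<rho>"
    and u: "\<And>s. s \<in> {0..T} \<Longrightarrow> norm (y q s) \<le> U"
    and y0: "\<And>k. k < q \<Longrightarrow> norm (y k 0) \<le> S"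
    and n: "n \<le> q" and t: "t \<in> {0..T}"
  shows "norm (y (q - n) t) \<le> (\<Sum>i<n. \<rho> ^ i) * S * exp (- c * t) + U"
  using n t
proof (induction n arbitrary: t)
  case 0
  then show ?case using u by simp
next
  case (Suc n)
  define k where "k = q - Suc n"
  have k: "k < q" "Suc k = q - n" using Suc.prems by (auto simp: k_def)
  have \<rho>0: "0 \<le> \<rho>" using \<rho>[OF k(1)] c(1) c(2)[OF k(1)] by (smt (verit) divide_nonneg_pos)
  define A where "A = (\<Sum>i<n. \<rho> ^ i) * S"
  have A: "0 \<le> A" using \<rho>0 nn by (simp add: A_def sum_nonneg)
  have "norm (y k t) \<le> (S + \<kappa> k / (\<kappa> k - c) * A) * exp (- c * t) + U"
    using Suc.IH Suc.prems k c y0[OF k(1)] nn A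
    by (intro lag_bound[where T = T and v = "y (Suc k)"] int) (auto simp: A_def)
  also have "\<dots> \<le> (S + \<rho> * A) * exp (- c * t) + U"
    by (intro add_right_mono mult_right_mono add_left_mono \<rho>[OF k(1)] A) auto
  also have "S + \<rho> * A = (\<Sum>i<Suc n. \<rho> ^ i) * S"
    by (simp add: A_def sum.lessThan_Suc_shift sum_distrib_left sum_distrib_right distrib_right
        mult.assoc del: sum.lessThan_Suc)
  finally show ?case by (simp add: k_def)
qed

text \<open>\<open>V\<close> is nonincreasing and bounded below, so after some \<open>T\<close> it
  has less than \<open>d\<close> left to lose. Then \<open>E\<close> cannot stay above
  \<open>d\<close>, and from there \<open>E' \<le> - k * V'\<close> lets it grow by at most
  \<open>k * d\<close>.\<close>

lemma dissipation_tendsto_0: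
  fixes V E V' E' :: "real \<Rightarrow> real"
  assumes V: "\<And>t. 0 \<le> t \<Longrightarrow> (V has_vector_derivative V' t) (at t within {0..})"
    and E: "\<And>t. 0 \<le> t \<Longrightarrow> (E has_vector_derivative E' t) (at t within {0..})"
    and nn: "\<And>t. 0 \<le> t \<Longrightarrow> 0 \<le> V t" "\<And>t. 0 \<le> t \<Longrightarrow> 0 \<le> E t"
    and c: "0 < c" "\<And>t. 0 \<le> t \<Longrightarrow> V' t \<le> - c * E t"
    and k: "0 \<le> k" "\<And>t. 0 \<le> t \<Longrightarrow> E' t \<le> - k * V' t"
  shows "(E \<longlongrightarrow> 0) at_top"
proof (rule tendstoI)
  fix e :: real assume e: "0 < e"
  define d where "d = e / (2 + k)"
  have d: "0 < d" "d + k * d < e"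
    using e k by (auto simp: d_def divide_simps) (auto simp: algebra_simps)
  have anti: "V t \<le> V s" if "0 \<le> s" "s \<le> t" for s t
  proof -
    have "V t - V s \<le> 0"
    proof (rule has_integral_le[OF has_vector_derivative_integral_0[OF V that] has_integral_0])
      fix w assume w: "w \<in> {s..t}"
      then have "V' w \<le> - c * E w" using c(2)[of w] that by simp
      also have "\<dots> \<le> 0" using nn(2)[of w] w that c by simp
      finally show "V' w \<le> 0" .
    qed
    then show ?thesis by simp
  qed
  have bdd: "bdd_below (V ` {0..})" using nn by (auto intro: bdd_belowI[of _ 0])
  define m where "m = Inf (V ` {0..})"
  have m: "m \<le> V t" if "0 \<le> t" for t using bdd that by (auto simp: m_def intro: cInf_lower)
  have "\<exists>v\<in>V ` {0..}. v < m + d"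
    using d bdd unfolding m_def by (intro cInf_lessD) auto
  then obtain T where T: "0 \<le> T" "V T < m + d" by auto
  have "\<exists>s\<ge>T. E s \<le> d"
  proof (rule ccontr)
    assume "\<not> (\<exists>s\<ge>T. E s \<le> d)"
    then have big: "d < E s" if "T \<le> s" for s using that by force
    \<comment> \<open>Long enough for \<open>V\<close> to lose \<open>2 * d\<close> at rate
      \<open>c * d\<close>, more than is left above the infimum.\<close>
    define s where "s = T + 2 / c"
    have Ts: "T \<le> s" using c by (simp add: s_def)
    have int_d: "((\<lambda>_. - c * d) has_integral (s - T) * (- c * d)) {T..s}"
      using has_integral_const_real[of "- c * d" T s] Ts by simp
    have "V s - V T \<le> (s - T) * (- c * d)"
    proof (rule has_integral_le[OF has_vector_derivative_integral_0[OF V T(1) Ts] int_d])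
      fix w assume w: "w \<in> {T..s}"
      have "V' w \<le> - c * E w" using c(2)[of w] w T by simp
      also have "\<dots> \<le> - c * d" using big[of w] w c by simp
      finally show "V' w \<le> - c * d" .
    qed
    also have "\<dots> = - 2 * d" using c by (simp add: s_def)
    finally show False using m[of s] T Ts d by simp
  qed
  then obtain s where s: "T \<le> s" "E s \<le> d" by blast
  have "dist (E t) 0 < e" if "s \<le> t" for t
  proof -
    have s0: "0 \<le> s" using s T by simp
    have "E t - E s \<le> - k * (V t - V s)"
      using has_vector_derivative_integral_0[OF E s0 that]
        has_integral_mult_right[OF has_vector_derivative_integral_0[OF V s0 that], of "- k"]
      by (rule has_integral_le) (use k s0 in auto)
    also have "V s - V t \<le> d" using anti[OF T(1) s(1)] m[of t] T s0 that by simp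
    then have "- k * (V t - V s) \<le> k * d" using mult_left_mono[OF _ k(1), of "V s - V t" d]
      by (simp add: algebra_simps)
    finally have "E t \<le> d + k * d" using s by simp
    then show ?thesis using d nn(2)[of t] s0 that by simp
  qed
  then show "\<forall>\<^sub>F t in at_top. dist (E t) 0 < e"
    by (auto simp: eventually_at_top_linorder)
qed

section \<open>The chain of coordinates\<close>

text \<open>The product of the factors \<open>1 + s / \<alpha> l\<close> for
  \<open>l = 1, ..., k\<close>, applied to \<open>e\<close> with \<open>s\<close> acting as the
  shift and read off at index 0. Starting the sequence at 0 lets one expression serve for positions,
  shifted sequences and vector fields.\<close>

definition stage :: "(nat \<Rightarrow> real) \<Rightarrow> nat \<Rightarrow> (nat \<Rightarrow> 'a::real_vector) \<Rightarrow> 'a" where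
  "stage \<alpha> k e = (\<Sum>j\<le>k. delta \<alpha> k j *\<^sub>R e j)"

lemma monic_delta_poly: "coeff (\<Prod>l\<in>{1..q}. [:1 / \<alpha> l, 1:]) q = (1 :: real)"
proof -
  have "degree (\<Prod>l\<in>{1..q}. [:1 / \<alpha> l, 1:]) = q"
    by (subst degree_prod_eq_sum_degree) auto
  moreover have "lead_coeff (\<Prod>l\<in>{1..q}. [:1 / \<alpha> l, 1:]) = 1"
    by (subst lead_coeff_prod) simp
  ultimately show ?thesis by metis
qed

lemma delta_0 [simp]: "delta \<alpha> q 0 = 1"
  by (simp add: delta_def monic_delta_poly[simplified])

text \<open>Comparison of coefficients after multiplication by one more linear factor. For
  \<open>j = k\<close> the truncated subtraction in \<open>delta \<alpha> k (Suc j)\<close> would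
  return the constant coefficient, so the diagonal is treated separately.\<close>

lemma delta_Suc:
  assumes "j < k"
  shows "delta \<alpha> (Suc k) (Suc j) = delta \<alpha> k (Suc j) + delta \<alpha> k j / \<alpha> (Suc k)"
proof -
  obtain n where n: "k - j = Suc n" using assms by (cases "k - j") auto
  then have "k - Suc j = n" "Suc k - Suc j = Suc n" by auto
  then show ?thesis using n by (simp add: delta_def prod.nat_ivl_Suc')
qed

lemma delta_diag: "delta \<alpha> (Suc k) (Suc k) = delta \<alpha> k k / \<alpha> (Suc k)"
  by (simp add: delta_def prod.nat_ivl_Suc')

lemma delta_diag_pos: "\<forall>k\<in>{1..q}. 0 < \<alpha> k \<Longrightarrow> 0 < delta \<alpha> q q"
  by (induction q) (auto simp: delta_diag)

lemma stage_0 [simp]: "stage \<alpha> 0 e = e 0"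
  by (simp add: stage_def)

text \<open>The polynomial identity \<open>P\<^sub>k\<^sub>+\<^sub>1(s) = (1 + s / \<alpha>\<^sub>k\<^sub>+\<^sub>1) P\<^sub>k(s)\<close>, with \<open>s\<close> acting as the shift.\<close>

lemma stage_Suc:
  "stage \<alpha> (Suc k) e = stage \<alpha> k e + (1 / \<alpha> (Suc k)) *\<^sub>R stage \<alpha> k (\<lambda>j. e (Suc j))"
proof -
  have "stage \<alpha> (Suc k) e
      = e 0 + (\<Sum>j<k. delta \<alpha> (Suc k) (Suc j) *\<^sub>R e (Suc j)) + delta \<alpha> (Suc k) (Suc k) *\<^sub>R e (Suc k)"
    unfolding stage_def sum.atMost_Suc_shift by (simp add: lessThan_Suc_atMost[symmetric])
  also have "(\<Sum>j<k. delta \<alpha> (Suc k) (Suc j) *\<^sub>R e (Suc j))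
      = (\<Sum>j<k. delta \<alpha> k (Suc j) *\<^sub>R e (Suc j))
        + (1 / \<alpha> (Suc k)) *\<^sub>R (\<Sum>j<k. delta \<alpha> k j *\<^sub>R e (Suc j))"
    by (simp add: delta_Suc scaleR_add_left sum.distrib scaleR_sum_right)
  finally have "stage \<alpha> (Suc k) e
      = (e 0 + (\<Sum>j<k. delta \<alpha> k (Suc j) *\<^sub>R e (Suc j)))
        + ((1 / \<alpha> (Suc k)) *\<^sub>R (\<Sum>j<k. delta \<alpha> k j *\<^sub>R e (Suc j))
          + delta \<alpha> (Suc k) (Suc k) *\<^sub>R e (Suc k))"
    by (simp add: add.assoc)
  also have "(1 / \<alpha> (Suc k)) *\<^sub>R (\<Sum>j<k. delta \<alpha> k j *\<^sub>R e (Suc j))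
        + delta \<alpha> (Suc k) (Suc k) *\<^sub>R e (Suc k) = (1 / \<alpha> (Suc k)) *\<^sub>R stage \<alpha> k (\<lambda>j. e (Suc j))"
    by (simp add: stage_def delta_diag scaleR_add_right lessThan_Suc_atMost[symmetric])
  also have "e 0 + (\<Sum>j<k. delta \<alpha> k (Suc j) *\<^sub>R e (Suc j)) = stage \<alpha> k e"
    by (simp add: stage_def sum.lessThan_Suc_shift lessThan_Suc_atMost[symmetric] del: sum.lessThan_Suc)
  finally show ?thesis .
qed

lemma stage_cong: "(\<And>j. j \<le> k \<Longrightarrow> e j = f j) \<Longrightarrow> stage \<alpha> k e = stage \<alpha> k f"
  by (simp add: stage_def)

text \<open>If \<open>e (Suc j)\<close> is the derivative of \<open>e j\<close>, the left side is
  the derivative of \<open>stage \<alpha> k e\<close>, and the identity is the lag equation.\<close>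

lemma stage_shift:
  "\<alpha> (Suc k) \<noteq> 0 \<Longrightarrow>
    stage \<alpha> k (\<lambda>j. e (Suc j)) = \<alpha> (Suc k) *\<^sub>R (stage \<alpha> (Suc k) e - stage \<alpha> k e)"
  by (simp add: stage_Suc)

lemma zeta_coord_eq_stage:
  "zeta_coord \<alpha> k x d = stage \<alpha> k (\<lambda>j. if j = 0 then x else d j)"
proof -
  have "{..k} = insert 0 {1..k}" by auto
  then show ?thesis by (simp add: zeta_coord_def stage_def)
qed

text \<open>Derivatives of the position, at index 0, and of its derivative blocks in one sequence;
  all rows but the last are a shift.\<close>

definition chain_field ::
    "(nat \<Rightarrow> real) \<Rightarrow> nat \<Rightarrow> (nat \<Rightarrow> real ^ 'n) \<Rightarrow> real ^ 'n \<Rightarrow> nat \<Rightarrow> real ^ 'n" where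
  "chain_field \<alpha> q d u j = (if j < q then d (Suc j) else derivative_field \<alpha> q q d u)"

lemma derivative_field_eq_chain_field:
  assumes "k \<in> {1..q}" shows "derivative_field \<alpha> q k d u = chain_field \<alpha> q d u k"
proof (cases "k < q")
  case True
  then have "derivative_field \<alpha> q k d u = (\<Sum>j\<in>{1..q}. if j = Suc k then d j else 0)"
    unfolding derivative_field_def
    by (simp add: companion_def input_gain_def if_distrib[of "\<lambda>a. a *\<^sub>R _"] cong: if_cong)
  then show ?thesis using True by (simp add: chain_field_def)
qed (use assms in \<open>simp add: chain_field_def\<close>)

text \<open>The last companion row is the expression of the input through the derivatives, solved
  for the highest one; inserting it gives the input back.\<close>

lemma stage_chain_field:
  assumes "\<forall>k\<in>{1..q}. 0 < \<alpha> k" "1 \<le> q" shows "stage \<alpha> q (chain_field \<alpha> q d u) = u"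
proof -
  have nz: "delta \<alpha> q q \<noteq> 0" using delta_diag_pos[OF assms(1)] by simp
  have "stage \<alpha> q (chain_field \<alpha> q d u)
      = (\<Sum>j<q. delta \<alpha> q j *\<^sub>R d (Suc j)) + delta \<alpha> q q *\<^sub>R derivative_field \<alpha> q q d u"
    by (simp add: stage_def chain_field_def lessThan_Suc_atMost[symmetric])
  also have "(\<Sum>j<q. delta \<alpha> q j *\<^sub>R d (Suc j)) = (\<Sum>j\<in>{1..q}. delta \<alpha> q (j - 1) *\<^sub>R d j)"
    by (rule sum.reindex_bij_witness[of _ "\<lambda>j. j - 1" Suc]) auto
  also have "delta \<alpha> q q *\<^sub>R derivative_field \<alpha> q q d u
      = (\<Sum>j\<in>{1..q}. - (delta \<alpha> q (j - 1) *\<^sub>R d j)) + u"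
    using nz by (simp add: derivative_field_def companion_def input_gain_def scaleR_diff_right
        scaleR_sum_right sum_negf)
  finally show ?thesis by (simp add: sum_negf)
qed

lemma norm_stage_le:
  fixes e :: "nat \<Rightarrow> 'a::real_normed_vector"
  assumes "\<And>j. j \<le> k \<Longrightarrow> norm (e j) \<le> s"
  shows "norm (stage \<alpha> k e) \<le> (\<Sum>j\<le>k. \<bar>delta \<alpha> k j\<bar>) * s"
  unfolding stage_def sum_distrib_right
  by (rule sum_norm_le) (use assms in \<open>auto intro: mult_left_mono\<close>)

text \<open>Differences of consecutive stages are, up to a factor, stages of the shifted sequence.
  The induction hypothesis is applied to that shift, which is why \<open>e\<close> and
  \<open>b\<close> are quantified after \<open>C\<close>.\<close>

lemma stages_control_terms:
  assumes "\<forall>j\<in>{1..k}. 0 < \<alpha> j"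
  shows "\<exists>C\<ge>0. \<forall>(e :: nat \<Rightarrow> 'a::real_normed_vector) b.
    (\<forall>j\<le>k. norm (stage \<alpha> j e) \<le> b) \<longrightarrow> norm (e k) \<le> C * b"
  using assms
proof (induction k)
  case 0
  show ?case by (rule exI[of _ 1]) auto
next
  case (Suc k)
  then obtain C where C: "0 \<le> C"
    "\<And>(e :: nat \<Rightarrow> 'a) b. (\<forall>j\<le>k. norm (stage \<alpha> j e) \<le> b) \<Longrightarrow> norm (e k) \<le> C * b" by auto
  define A where "A = (\<Sum>j\<in>{1..Suc k}. \<alpha> j)"
  have A: "\<alpha> j \<le> A" if "j \<in> {1..Suc k}" for j
    unfolding A_def using that Suc.prems by (intro member_le_sum) (auto intro: less_imp_le)
  have A0: "0 \<le> A" unfolding A_def using Suc.prems by (intro sum_nonneg) (auto intro: less_imp_le)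
  have "norm (e (Suc k)) \<le> C * (A * 2) * b"
    if *: "\<forall>j\<le>Suc k. norm (stage \<alpha> j e) \<le> b" for e :: "nat \<Rightarrow> 'a" and b
  proof -
    have "norm (stage \<alpha> j (\<lambda>i. e (Suc i))) \<le> A * (2 * b)" if j: "j \<le> k" for j
    proof -
      have pos: "0 < \<alpha> (Suc j)" using Suc.prems j by auto
      have "norm (stage \<alpha> j (\<lambda>i. e (Suc i)))
          = \<alpha> (Suc j) * norm (stage \<alpha> (Suc j) e - stage \<alpha> j e)"
        using pos by (subst stage_shift) auto
      also have "\<dots> \<le> A * (b + b)"
        using pos A[of "Suc j"] j A0
        by (intro mult_mono order_trans[OF norm_triangle_ineq4] add_mono) (auto intro: *[rule_format])
      finally show ?thesis by simp
    qed
    then have "norm (e (Suc k)) \<le> C * (A * (2 * b))"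
      using C(2)[of "\<lambda>i. e (Suc i)" "A * (2 * b)"] by auto
    then show ?thesis by (simp add: mult.assoc)
  qed
  then show ?case using C(1) A0 by (intro exI[of _ "C * (A * 2)"]) auto
qed

section \<open>Input-to-state stability of the derivative blocks\<close>

lemma class_KL_exp:
  assumes "0 < C" "0 < c" shows "class_KL (\<lambda>s t. C * s * exp (- c * t))"
proof -
  have "((\<lambda>t. C * s * exp (- c * t)) \<longlongrightarrow> C * s * 0) at_top" for s
    using assms
    by (intro tendsto_mult tendsto_const filterlim_compose[OF exp_at_bot]
        filterlim_tendsto_neg_mult_at_bot[OF tendsto_const _ filterlim_ident]) auto
  then show ?thesis
    using assms unfolding class_KL_def class_K_def case_prod_unfold
    by (auto intro!: continuous_intros monotone_onI strict_mono_onI mult_left_mono)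
qed

lemma class_K_linear: "0 < C \<Longrightarrow> class_K (\<lambda>s. C * s)"
  unfolding class_K_def by (auto intro!: continuous_intros strict_mono_onI)

text \<open>The stages of the blocks form a chain of lags driven by \<open>u\<close>, estimated by
  \<open>cascade_bound\<close>. \<open>norm_stage_le\<close> translates from blocks to stages at
  time 0, and \<open>stages_control_terms\<close> translates back at time \<open>T\<close>.\<close>

lemma ISS_derivative_field:
  assumes \<alpha>: "\<forall>k\<in>{1..q}. 0 < \<alpha> k"
  shows "ISS {1..q} (derivative_field \<alpha> q :: nat \<Rightarrow> (nat \<Rightarrow> real ^ 'n) \<Rightarrow> real ^ 'n \<Rightarrow> real ^ 'n)"
proof -
  \<comment> \<open>Strictly below every rate of the chain; the element 1 keeps the minimum defined
    for \<open>q = 0\<close>.\<close>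
  define c where "c = Min (insert 1 (\<alpha> ` {1..q})) / 2"
  have "0 < Min (insert 1 (\<alpha> ` {1..q}))" using \<alpha> by (subst Min_gr_iff) auto
  moreover have "Min (insert 1 (\<alpha> ` {1..q})) \<le> \<alpha> k" if "k \<in> {1..q}" for k
    using that by (intro Min_le) auto
  ultimately have c: "0 < c" "c < \<alpha> k" if "k \<in> {1..q}" for k
    using that \<alpha> by (auto simp: c_def) (smt (verit) atLeastAtMost_iff field_sum_of_halves)
  have c0: "0 < c" using \<open>0 < Min _\<close> by (simp add: c_def)
  define \<rho> where "\<rho> = (\<Sum>k<q. \<alpha> (Suc k) / (\<alpha> (Suc k) - c))"
  have pos\<rho>: "0 \<le> \<alpha> (Suc k) / (\<alpha> (Suc k) - c)" if "k < q" for k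
    using c[of "Suc k"] c0 that by auto
  have \<rho>: "\<alpha> (Suc k) / (\<alpha> (Suc k) - c) \<le> \<rho>" if "k < q" for k
    unfolding \<rho>_def using that pos\<rho> by (intro member_le_sum) auto
  have \<rho>0: "0 \<le> \<rho>" unfolding \<rho>_def using pos\<rho> by (intro sum_nonneg) auto
  define D where "D = (\<Sum>k<q. \<Sum>j\<le>k. \<bar>delta \<alpha> k j\<bar>)"
  have D: "(\<Sum>j\<le>k. \<bar>delta \<alpha> k j\<bar>) \<le> D" if "k < q" for k
    unfolding D_def using that by (intro member_le_sum) (auto intro: sum_nonneg)
  have D0: "0 \<le> D" unfolding D_def by (intro sum_nonneg) auto
  define P where "P = (\<Sum>i<q. \<rho> ^ i)"
  have P0: "0 \<le> P" unfolding P_def using \<rho>0 by (intro sum_nonneg) auto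
  have "\<forall>k<q. \<exists>C\<ge>0. \<forall>(e :: nat \<Rightarrow> real ^ 'n) b.
      (\<forall>j\<le>k. norm (stage \<alpha> j e) \<le> b) \<longrightarrow> norm (e k) \<le> C * b"
    using \<alpha> by (intro allI impI stages_control_terms) auto
  then obtain C where C: "\<And>k. k < q \<Longrightarrow> 0 \<le> C k"
    "\<And>k e b. k < q \<Longrightarrow> (\<forall>j\<le>k. norm (stage \<alpha> j (e :: nat \<Rightarrow> real ^ 'n)) \<le> b) \<Longrightarrow> norm (e k) \<le> C k * b"
    by metis
  define Q where "Q = (\<Sum>k<q. C k)"
  have Q0: "0 \<le> Q" unfolding Q_def using C by (intro sum_nonneg) auto
  \<comment> \<open>The summand 1, here and in \<open>C2\<close>, makes the gains strictly positive,
    as strictly increasing comparison functions require.\<close>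
  define C1 where "C1 = Q * P * D + 1"
  define C2 where "C2 = Q + 1"
  have C12: "0 < C1" "0 < C2" using Q0 P0 D0 by (auto simp: C1_def C2_def add_nonneg_pos)
  have est: "L2_set (\<lambda>k. norm (x k T)) {1..q}
      \<le> C1 * L2_set (\<lambda>k. norm (x k 0)) {1..q} * exp (- c * T) + C2 * (SUP s\<in>{0..T}. norm (u s))"
    if T: "0 \<le> T" and bdd: "bounded (u ` {0..T})"
      and int: "\<forall>k\<in>{1..q}. \<forall>t\<in>{0..T}.
        ((\<lambda>s. derivative_field \<alpha> q k (\<lambda>j. x j s) (u s)) has_integral (x k t - x k 0)) {0..t}"
    for T and u :: "real \<Rightarrow> real ^ 'n" and x :: "nat \<Rightarrow> real \<Rightarrow> real ^ 'n"
  proof -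
    define S where "S = L2_set (\<lambda>k. norm (x k 0)) {1..q}"
    define U where "U = (SUP s\<in>{0..T}. norm (u s))"
    have bdd': "bdd_above ((\<lambda>s. norm (u s)) ` {0..T})"
      using bdd unfolding bounded_iff by (auto intro: bdd_aboveI2)
    have U: "norm (u s) \<le> U" if "s \<in> {0..T}" for s
      unfolding U_def using that bdd' by (intro cSUP_upper) auto
    have U0: "0 \<le> U" using U[of 0] T by (auto intro: order_trans[OF norm_ge_zero])
    have S0: "0 \<le> S" by (simp add: S_def L2_set_nonneg)
    \<comment> \<open>Block \<open>Suc j\<close> stands at place \<open>j\<close>, so the sequence
      starts with the velocity. The chain ends with the input itself, which need not be
      continuous.\<close>
    define y where
      "y k s = (if k < q then stage \<alpha> k (\<lambda>j. x (Suc j) s) else u s)" for k s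
    have y_stage: "y k s = stage \<alpha> k (chain_field \<alpha> q (\<lambda>j. x j s) (u s))" if "k \<le> q" "1 \<le> q" for k s
    proof (cases "k < q")
      case True
      then show ?thesis by (auto simp: y_def chain_field_def intro!: stage_cong)
    next
      case False
      then have "k = q" using that by simp
      then show ?thesis using that by (simp add: y_def stage_chain_field[OF \<alpha>])
    qed
    have yb: "norm (y (q - n) T) \<le> (\<Sum>i<n. \<rho> ^ i) * (D * S) * exp (- c * T) + U" if "n \<le> q" for n
    proof (rule cascade_bound[where T = T and \<kappa> = "\<lambda>k. \<alpha> (Suc k)"])
      fix k t assume k: "k < q" and t: "t \<in> {0..T}"
      have "((\<lambda>s. stage \<alpha> k (\<lambda>j. derivative_field \<alpha> q (Suc j) (\<lambda>j. x j s) (u s)))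
          has_integral stage \<alpha> k (\<lambda>j. x (Suc j) t - x (Suc j) 0)) {0..t}"
        unfolding stage_def using int t k by (intro has_integral_sum has_integral_cmul) auto
      moreover have "stage \<alpha> k (\<lambda>j. derivative_field \<alpha> q (Suc j) (\<lambda>j. x j s) (u s))
          = \<alpha> (Suc k) *\<^sub>R (y (Suc k) s - y k s)" for s
      proof -
        have "\<alpha> (Suc k) \<noteq> 0" using \<alpha> k by (auto simp: less_le)
        moreover have "stage \<alpha> k (\<lambda>j. derivative_field \<alpha> q (Suc j) (\<lambda>j. x j s) (u s))
            = stage \<alpha> k (\<lambda>j. chain_field \<alpha> q (\<lambda>j. x j s) (u s) (Suc j))"
          using k by (intro stage_cong derivative_field_eq_chain_field) auto
        ultimately show ?thesis using k by (simp add: y_stage stage_shift)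
      qed
      moreover have "stage \<alpha> k (\<lambda>j. x (Suc j) t - x (Suc j) 0) = y k t - y k 0"
        using k by (simp add: y_def stage_def scaleR_diff_right sum_subtractf)
      ultimately show "((\<lambda>s. \<alpha> (Suc k) *\<^sub>R (y (Suc k) s - y k s)) has_integral (y k t - y k 0)) {0..t}"
        by simp
    next
      fix k assume k: "k < q"
      have "norm (x (Suc j) 0) \<le> S" if "j \<le> k" for j
        unfolding S_def using k that by (intro member_le_L2_set) auto
      then have "norm (y k 0) \<le> (\<Sum>j\<le>k. \<bar>delta \<alpha> k j\<bar>) * S"
        using k by (simp add: y_def norm_stage_le)
      also have "\<dots> \<le> D * S" using D[OF k] S0 by (rule mult_right_mono)
      finally show "norm (y k 0) \<le> D * S" .
    qed (use T c0 c U U0 S0 D0 \<rho> that in \<open>auto simp: y_def\<close>)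
    define b where "b = P * (D * S) * exp (- c * T) + U"
    have yb': "norm (stage \<alpha> k (\<lambda>j. x (Suc j) T)) \<le> b" if "k < q" for k
    proof -
      have "norm (stage \<alpha> k (\<lambda>j. x (Suc j) T)) \<le> (\<Sum>i<q - k. \<rho> ^ i) * (D * S) * exp (- c * T) + U"
        using yb[of "q - k"] that by (simp add: y_def)
      also have "(\<Sum>i<q - k. \<rho> ^ i) \<le> P"
        unfolding P_def using \<rho>0 by (intro sum_mono2) auto
      then have "(\<Sum>i<q - k. \<rho> ^ i) * (D * S) * exp (- c * T) + U \<le> b"
        unfolding b_def using D0 S0 by (intro add_mono mult_right_mono) auto
      finally show ?thesis .
    qed
    have "L2_set (\<lambda>k. norm (x k T)) {1..q} \<le> (\<Sum>k\<in>{1..q}. norm (x k T))"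
      by (rule L2_set_le_sum) simp
    also have "\<dots> = (\<Sum>k<q. norm (x (Suc k) T))"
      by (rule sum.reindex_bij_witness[of _ Suc "\<lambda>j. j - 1"]) auto
    also have "\<dots> \<le> (\<Sum>k<q. C k * b)"
      using C(2)[of _ "\<lambda>j. x (Suc j) T"] yb' by (intro sum_mono) auto
    also have "\<dots> = Q * b"
      by (simp add: Q_def sum_distrib_right)
    also have "\<dots> = Q * P * D * (S * exp (- c * T)) + Q * U"
      by (simp add: b_def algebra_simps)
    also have "\<dots> \<le> C1 * (S * exp (- c * T)) + C2 * U"
      using S0 U0 unfolding C1_def C2_def by (intro add_mono mult_right_mono) auto
    finally show ?thesis by (simp add: S_def U_def mult.assoc)
  qed
  show ?thesis
    unfolding ISS_def
    by (intro exI[of _ "\<lambda>s t. C1 * s * exp (- c * t)"] exI[of _ "\<lambda>s. C2 * s"] conjI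
        class_KL_exp class_K_linear C12 c0 allI impI est)
qed

section \<open>Variational inequality and equilibria of the game\<close>

lemma inner_transpose: "(transpose M *v a) \<bullet> b = a \<bullet> (M *v b)"
  for M :: "real ^ 'n ^ 'm"
  by (simp add: dot_lmul_matrix)

text \<open>Each solution serves as a test vector for the other.\<close>

lemma VI_unique:
  assumes F: "strongly_monotone \<mu> F" and \<mu>: "0 < \<mu>" and xy: "VI_solution X F x" "VI_solution X F y"
  shows "x = y"
proof -
  have "0 \<le> (y - x) \<bullet> F x" "0 \<le> (x - y) \<bullet> F y"
    using xy by (auto simp: VI_solution_def)
  moreover have "\<mu> * (norm (x - y))\<^sup>2 \<le> (F x - F y) \<bullet> (x - y)"
    using F by (simp add: strongly_monotone_def)
  ultimately have "\<mu> * (norm (x - y))\<^sup>2 \<le> 0"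
    by (simp add: inner_diff_left inner_diff_right inner_commute)
  then show ?thesis using \<mu> by (simp add: mult_le_0_iff)
qed

text \<open>Fixed points of the projected step \<open>x - \<gamma> *\<^sub>R F x\<close> solve the
  inequality, and strong monotonicity with the Lipschitz bound makes this map a contraction.\<close>

lemma VI_exists:
  fixes F :: "real ^ 'n \<Rightarrow> real ^ 'n"
  assumes X: "closed X" "convex X" "X \<noteq> {}"
    and F: "strongly_monotone \<mu> F" "\<theta>-lipschitz_on UNIV F" and pos: "0 < \<mu>" "0 < \<theta>"
  shows "\<exists>x. VI_solution X F x"
proof -
  \<comment> \<open>The minimiser of
    \<open>1 - 2 * \<gamma> * \<mu> + \<gamma>^2 * \<theta>^2\<close>, which bounds the squared
    contraction factor.\<close>
  define \<gamma> where "\<gamma> = \<mu> / \<theta>\<^sup>2"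
  have \<gamma>: "0 < \<gamma>" using pos by (simp add: \<gamma>_def)
  define P where "P x = closest_point X (x - \<gamma> *\<^sub>R F x)" for x
  define \<kappa> where "\<kappa> = max 0 (1 - \<mu>\<^sup>2 / \<theta>\<^sup>2)"
  have contr: "dist (P x) (P y) \<le> sqrt \<kappa> * dist x y" for x y
  proof -
    have "norm (F x - F y) \<le> \<theta> * norm (x - y)"
      using F(2) by (auto simp: lipschitz_on_def dist_norm)
    then have lip: "(norm (F x - F y))\<^sup>2 \<le> \<theta>\<^sup>2 * (norm (x - y))\<^sup>2"
      by (metis norm_ge_zero power_mono power_mult_distrib)
    have mono: "\<mu> * (norm (x - y))\<^sup>2 \<le> (F x - F y) \<bullet> (x - y)"
      using F(1) by (simp add: strongly_monotone_def)
    have "(dist (P x) (P y))\<^sup>2 \<le> (dist (x - \<gamma> *\<^sub>R F x) (y - \<gamma> *\<^sub>R F y))\<^sup>2"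
      unfolding P_def using X by (intro power_mono closest_point_lipschitz) auto
    also have "\<dots> = (norm ((x - y) - \<gamma> *\<^sub>R (F x - F y)))\<^sup>2"
      by (simp add: dist_norm algebra_simps)
    also have "\<dots> = (norm (x - y))\<^sup>2 - 2 * \<gamma> * ((F x - F y) \<bullet> (x - y)) + \<gamma>\<^sup>2 * (norm (F x - F y))\<^sup>2"
      unfolding power2_norm_eq_inner
      by (simp add: inner_diff_left[of "x - y" "\<gamma> *\<^sub>R (F x - F y)"]
          inner_diff_right[of _ "x - y" "\<gamma> *\<^sub>R (F x - F y)"] inner_commute power2_eq_square)
    also have "\<dots> \<le> (norm (x - y))\<^sup>2 - 2 * \<gamma> * (\<mu> * (norm (x - y))\<^sup>2) + \<gamma>\<^sup>2 * (\<theta>\<^sup>2 * (norm (x - y))\<^sup>2)"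
      using lip mono \<gamma> by (intro add_mono diff_mono mult_left_mono) auto
    also have "\<dots> = (1 - \<mu>\<^sup>2 / \<theta>\<^sup>2) * (norm (x - y))\<^sup>2"
      using pos by (simp add: \<gamma>_def field_simps power2_eq_square)
    also have "\<dots> \<le> \<kappa> * (norm (x - y))\<^sup>2"
      unfolding \<kappa>_def by (intro mult_right_mono) auto
    also have "\<dots> = (sqrt \<kappa> * dist x y)\<^sup>2"
      by (simp add: power_mult_distrib \<kappa>_def dist_norm)
    finally show ?thesis
      by (rule power2_le_imp_le) (simp add: \<kappa>_def)
  qed
  have "\<exists>!x\<in>X. P x = x"
  proof (rule Banach_fix[OF _ X(3) _ _ _ contr])
    show "complete X" using X by (simp add: complete_eq_closed)
    show "sqrt \<kappa> < 1" using pos by (simp add: \<kappa>_def)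
    show "P ` X \<subseteq> X" using X by (auto simp: P_def intro: closest_point_in_set)
  qed (simp add: \<kappa>_def)
  then obtain x where x: "x \<in> X" "P x = x" by blast
  have "0 \<le> (y - x) \<bullet> F x" if "y \<in> X" for y
  proof -
    have "(x - \<gamma> *\<^sub>R F x - x) \<bullet> (y - x) \<le> 0"
      using closest_point_dot[OF X(2,1) that, of "x - \<gamma> *\<^sub>R F x"] x by (simp add: P_def)
    then show ?thesis using \<gamma> by (simp add: inner_commute zero_le_mult_iff)
  qed
  then show ?thesis using x by (auto simp: VI_solution_def)
qed

section \<open>Individual optimality and the variational inequality\<close>

lemma GDERIV_unique: "GDERIV f x :> D \<Longrightarrow> GDERIV f x :> D' \<Longrightarrow> D = D'"
  unfolding gderiv_def
  by (drule (1) has_derivative_unique) (metis vector_eq_ldot)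

text \<open>Restriction to the line through \<open>x\<close> and \<open>y\<close> reduces this to
  the tangent inequality for convex functions of one real variable.\<close>

lemma convex_gradient_le:
  fixes f :: "real ^ 'n \<Rightarrow> real"
  assumes f: "convex_on UNIV f" and D: "GDERIV f x :> D"
  shows "(y - x) \<bullet> D \<le> f y - f x"
proof -
  define \<phi> where "\<phi> t = f (x + t *\<^sub>R (y - x))" for t :: real
  have "convex_on UNIV \<phi>"
  proof (rule convex_onI)
    fix t a b :: real assume t: "0 < t" "t < 1"
    have "x + ((1 - t) *\<^sub>R a + t *\<^sub>R b) *\<^sub>R (y - x)
        = (1 - t) *\<^sub>R (x + a *\<^sub>R (y - x)) + t *\<^sub>R (x + b *\<^sub>R (y - x))"
      by (simp add: algebra_simps)
    then show "\<phi> ((1 - t) *\<^sub>R a + t *\<^sub>R b) \<le> (1 - t) * \<phi> a + t * \<phi> b"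
      unfolding \<phi>_def using convex_onD[OF f, of t] t by simp
  qed simp
  moreover have "(\<phi> has_real_derivative ((y - x) \<bullet> D)) (at 0)"
  proof -
    have *: "(f has_derivative (\<lambda>h. h \<bullet> D)) (at (x + 0 *\<^sub>R (y - x)))"
      using D by (simp add: gderiv_def)
    have "((\<lambda>t. x + t *\<^sub>R (y - x)) has_derivative (\<lambda>t. t *\<^sub>R (y - x))) (at 0)"
      by (auto intro!: derivative_eq_intros)
    from diff_chain_at[OF this *] show ?thesis
      by (simp add: \<phi>_def[abs_def] o_def has_field_derivative_def mult_commute_abs)
  qed
  ultimately have "((y - x) \<bullet> D) * (1 - 0) \<le> \<phi> 1 - \<phi> 0"
    by (intro convex_on_imp_above_tangent[where A = UNIV]) auto
  then show ?thesis by (simp add: \<phi>_def)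
qed

lemma replace_replace [simp]: "replace own i (replace own i y x) x = replace own i y x"
  by (simp add: replace_def vec_eq_iff)

lemma replace_self [simp]: "replace own i x x = x"
  by (simp add: replace_def vec_eq_iff)

text \<open>\<open>replace own i y x - x\<close> vanishes outside block \<open>i\<close>, and on
  that block the pseudo-gradient is the gradient of the cost of player \<open>i\<close>.\<close>

lemma block_gradient_le:
  assumes C1: "\<And>i w. continuously_differentiable (\<lambda>y. J i (replace own i y w))"
    and cvx: "\<And>i w. convex_on UNIV (\<lambda>y. J i (replace own i y w))"
  shows "(replace own i y x - x) \<bullet> pseudo_gradient own J x \<le> J i (replace own i y x) - J i x"
proof -
  obtain D where D: "GDERIV (\<lambda>y. J i (replace own i y x)) x :> D"
    using C1[of i x] by (auto simp: continuously_differentiable_def)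
  then have bg: "block_gradient own i (J i) x = D"
    unfolding block_gradient_def by (rule the_equality) (rule GDERIV_unique[OF _ D])
  have "(replace own i y x - x) \<bullet> pseudo_gradient own J x = (replace own i y x - x) \<bullet> D"
    unfolding inner_vec_def
    by (rule sum.cong) (auto simp: replace_def pseudo_gradient_def bg)
  also have "\<dots> \<le> J i (replace own i y x) - J i x"
    using convex_gradient_le[OF cvx D, of "replace own i y x"] by simp
  finally show ?thesis .
qed

text \<open>A feasible unilateral deviation is a test vector for the variational inequality, and
  convexity turns the first-order condition into optimality.\<close>

lemma VI_imp_best_response:
  assumes C1: "\<And>i w. continuously_differentiable (\<lambda>y. J i (replace own i y w))"
    and cvx: "\<And>i w. convex_on UNIV (\<lambda>y. J i (replace own i y w))"
    and VI: "VI_solution X (pseudo_gradient own J) x" and y: "replace own i y x \<in> X"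
  shows "J i x \<le> J i (replace own i y x)"
proof -
  have "0 \<le> (replace own i y x - x) \<bullet> pseudo_gradient own J x"
    using VI y by (auto simp: VI_solution_def)
  then show ?thesis using block_gradient_le[OF C1 cvx, of i y x] by simp
qed

lemma v_GNE_iff_VI:
  assumes C1: "\<And>i w. continuously_differentiable (\<lambda>y. J i (replace own i y w))"
    and cvx: "\<And>i w. convex_on UNIV (\<lambda>y. J i (replace own i y w))"
  shows "v_GNE own J X x \<longleftrightarrow> VI_solution X (pseudo_gradient own J) x"
  using VI_imp_best_response[OF C1 cvx]
  by (auto simp: v_GNE_def GNE_def is_arg_min_linorder VI_solution_def)

text \<open>The cost does not see the derivative part of a decision, and the zero sequence meets the
  constraint on it, whence the witness.\<close>

lemma transformed_v_GNE_iff_VI: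
  assumes C1: "\<And>i w. continuously_differentiable (\<lambda>y. J i (replace own i y w))"
    and cvx: "\<And>i w. convex_on UNIV (\<lambda>y. J i (replace own i y w))"
  shows "transformed_v_GNE own J X q x \<longleftrightarrow> VI_solution X (pseudo_gradient own J) x"
  using VI_imp_best_response[OF C1 cvx]
  by (auto simp: transformed_v_GNE_def transformed_GNE_def is_arg_min_linorder VI_solution_def
      intro!: exI[of _ "\<lambda>_. 0"])

section \<open>The polyhedral feasible set and its multipliers\<close>

lemma feasible_iff: "x \<in> feasible_set G H \<longleftrightarrow> (\<forall>k. (G *v x) $ k \<le> H $ k)"
  by (simp add: feasible_set_def less_eq_vec_def)

lemma feasible_set_eq_transformed_set: "feasible_set G H = transformed_set G H"
  by (auto simp: feasible_iff transformed_set_def less_eq_vec_def)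

lemma feasible_set_polyhedral:
  "feasible_set G H = (\<Inter>k. {x. G $ k \<bullet> x \<le> H $ k})"
  by (auto simp: feasible_iff matrix_vector_mul_component)

lemma closed_feasible_set: "closed (feasible_set G H)"
  unfolding feasible_set_polyhedral by (intro closed_INT ballI closed_halfspace_le)

lemma convex_feasible_set: "convex (feasible_set G H)"
  unfolding feasible_set_polyhedral by (intro convex_INT convex_halfspace_le)

text \<open>The solvability half of the Fredholm alternative: the component of \<open>b\<close>
  orthogonal to the range lies in the kernel of the transpose, hence is orthogonal to
  \<open>b\<close> and so to itself.\<close>

lemma range_matrix_vector:
  fixes M :: "real ^ 'n ^ 'm"
  assumes "\<And>r. transpose M *v r = 0 \<Longrightarrow> r \<bullet> b = 0"
  shows "\<exists>v. M *v v = b"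
proof -
  have sub: "subspace (range ((*v) M))"
    by (intro linear_subspace_image matrix_vector_mul_linear subspace_UNIV)
  obtain s r where s: "s \<in> span (range ((*v) M))"
    and r: "\<And>w. w \<in> span (range ((*v) M)) \<Longrightarrow> orthogonal r w" and b: "b = s + r"
    using orthogonal_subspace_decomp_exists[of "range ((*v) M)" b] by blast
  have "(transpose M *v r) \<bullet> w = 0" for w
    unfolding inner_transpose using r[OF span_base] by (auto simp: orthogonal_def)
  then have "transpose M *v r = 0" by (metis inner_eq_zero_iff)
  then have "r \<bullet> b = 0" by (rule assms)
  moreover have "r \<bullet> s = 0" using r[OF s] by (simp add: orthogonal_def)
  ultimately have "b = s" using b by (simp add: inner_add_right)
  then show ?thesis using s sub by (auto simp: span_eq_iff[THEN iffD2])
qed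

text \<open>Full row rank makes every direction \<open>G *v d\<close> available, so that no Farkas lemma is needed.\<close>

lemma VI_multiplier:
  fixes G :: "real ^ 'n ^ 'm"
  assumes rank: "rank G = CARD('m)" and VI: "VI_solution (feasible_set G H) F x"
  shows "\<exists>\<nu>\<ge>0. F x + transpose G *v \<nu> = 0 \<and> \<nu> \<bullet> (H - G *v x) = 0"
proof -
  have surj: "\<exists>d. G *v d = w" for w
    using rank unfolding full_rank_surjective by (metis surjD)
  have feas: "(G *v x) $ k \<le> H $ k" for k
    using VI by (auto simp: VI_solution_def feasible_iff)
  have dir: "0 \<le> d \<bullet> F x" if "\<And>k. (G *v x) $ k + (G *v d) $ k \<le> H $ k" for d
  proof -
    have "x + d \<in> feasible_set G H"
      using that by (simp add: feasible_iff matrix_vector_right_distrib)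
    then show ?thesis using VI by (auto simp: VI_solution_def dest: bspec[of _ _ "x + d"])
  qed
  \<comment> \<open>A direction in the kernel of \<open>G\<close> is feasible with both signs, so
    \<open>F x\<close> is orthogonal to the kernel.\<close>
  have "\<exists>\<nu>. transpose G *v \<nu> = - F x"
  proof (rule range_matrix_vector)
    fix d assume "transpose (transpose G) *v d = 0"
    then have "G *v d = 0" "G *v (- d) = 0"
      by (simp_all add: linear_neg[OF matrix_vector_mul_linear])
    then show "d \<bullet> - F x = 0"
      using dir[of d] dir[of "- d"] feas by simp
  qed
  then obtain \<nu> where \<nu>: "transpose G *v \<nu> = - F x" by blast
  have dF: "d \<bullet> F x = - (\<nu> \<bullet> (G *v d))" for d
    using inner_transpose[of G \<nu> d] unfolding \<nu> by (simp add: inner_commute)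
  have nonneg: "0 \<le> \<nu> $ k" for k
  proof -
    \<comment> \<open>Moving inward across constraint \<open>k\<close> with the others unchanged
      keeps \<open>x\<close> feasible and tests the sign of \<open>\<nu> $ k\<close>.\<close>
    obtain d where d: "G *v d = - axis k 1" using surj by blast
    have "(G *v x) $ j + (G *v d) $ j \<le> H $ j" for j
      using feas[of j] by (auto simp: d axis_def)
    then show ?thesis using dir[of d] by (simp add: dF d inner_axis)
  qed
  have compl: "\<nu> $ k * (H $ k - (G *v x) $ k) = 0" for k
  proof -
    \<comment> \<open>This direction uses up the whole slack of constraint \<open>k\<close> and
      touches no other.\<close>
    obtain d where d: "G *v d = axis k (H $ k - (G *v x) $ k)" using surj by blast
    have "(G *v x) $ j + (G *v d) $ j \<le> H $ j" for j
      using feas[of j] by (auto simp: d axis_def)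
    then have "\<nu> $ k * (H $ k - (G *v x) $ k) \<le> 0" using dir[of d] by (simp add: dF d inner_axis)
    moreover have "0 \<le> \<nu> $ k * (H $ k - (G *v x) $ k)" using nonneg[of k] feas[of k] by simp
    ultimately show ?thesis by simp
  qed
  have "\<nu> \<bullet> (H - G *v x) = 0"
    unfolding inner_vec_def by (intro sum.neutral) (use compl in simp)
  then show ?thesis using nonneg \<nu> by (intro exI[of _ \<nu>]) (simp add: less_eq_vec_def)
qed

section \<open>The graph Laplacian and consensus vectors\<close>

lemma laplacian_component:
  "(kron_id (laplacian A) *v v) $ (i, k) = (\<Sum>j\<in>UNIV. A $ i $ j * (v $ (i, k) - v $ (j, k)))"
  for v :: "real ^ ('i::finite \<times> 'm::finite)"
proof -
  have "(kron_id (laplacian A) *v v) $ (i, k)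
      = (\<Sum>p\<in>UNIV \<times> UNIV. if snd p = k then laplacian A $ i $ fst p * v $ p else 0)"
    unfolding UNIV_Times_UNIV by (auto simp: matrix_vector_mult_def kron_id_def intro!: sum.cong)
  also have "\<dots> = (\<Sum>j\<in>UNIV. \<Sum>k'\<in>UNIV. if k' = k then laplacian A $ i $ j * v $ (j, k') else 0)"
    by (subst sum.cartesian_product) (auto intro!: sum.cong)
  also have "\<dots> = (\<Sum>j\<in>UNIV. laplacian A $ i $ j * v $ (j, k))"
    by simp
  also have "\<dots> = (\<Sum>j\<in>UNIV. (if j = i then (\<Sum>l\<in>UNIV. A $ i $ l) * v $ (i, k) else 0)
      - A $ i $ j * v $ (j, k))"
    by (intro sum.cong) (auto simp: laplacian_def left_diff_distrib)
  also have "\<dots> = (\<Sum>l\<in>UNIV. A $ i $ l) * v $ (i, k) - (\<Sum>j\<in>UNIV. A $ i $ j * v $ (j, k))"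
    by (simp add: sum_subtractf)
  finally show ?thesis
    by (simp add: right_diff_distrib sum_subtractf sum_distrib_right)
qed

text \<open>Since the weights are symmetric, exchanging \<open>i\<close> and \<open>j\<close> does
  not change the sum; the average of both versions is the claim. Symmetry and, for nonnegative
  weights, positive semidefiniteness can be read off.\<close>

lemma laplacian_form:
  fixes v w :: "real ^ ('i::finite \<times> 'm::finite)"
  assumes sym: "\<And>i j. A $ i $ j = A $ j $ i"
  shows "v \<bullet> (kron_id (laplacian A) *v w) = 1 / 2 * (\<Sum>k\<in>UNIV. \<Sum>i\<in>UNIV. \<Sum>j\<in>UNIV.
    A $ i $ j * ((v $ (i, k) - v $ (j, k)) * (w $ (i, k) - w $ (j, k))))"
proof -
  define T where
    "T k = (\<Sum>i\<in>UNIV. \<Sum>j\<in>UNIV. A $ i $ j * (v $ (i, k) * (w $ (i, k) - w $ (j, k))))" for k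
  have "v \<bullet> (kron_id (laplacian A) *v w)
      = (\<Sum>i\<in>UNIV. \<Sum>k\<in>UNIV. v $ (i, k) * (kron_id (laplacian A) *v w) $ (i, k))"
    by (simp add: inner_vec_def sum.cartesian_product split_def)
  also have "\<dots> = (\<Sum>k\<in>UNIV. T k)"
    unfolding T_def laplacian_component
    by (subst sum.swap) (simp add: sum_distrib_left mult.left_commute)
  finally have vT: "v \<bullet> (kron_id (laplacian A) *v w) = (\<Sum>k\<in>UNIV. T k)" .
  have "T k = 1 / 2 * (\<Sum>i\<in>UNIV. \<Sum>j\<in>UNIV.
      A $ i $ j * ((v $ (i, k) - v $ (j, k)) * (w $ (i, k) - w $ (j, k))))" for k
  proof -
    have "T k = (\<Sum>i\<in>UNIV. \<Sum>j\<in>UNIV. A $ i $ j * (v $ (j, k) * (w $ (j, k) - w $ (i, k))))"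
      unfolding T_def by (subst sum.swap) (simp add: sym)
    then have "T k + T k = (\<Sum>i\<in>UNIV. \<Sum>j\<in>UNIV.
        A $ i $ j * (v $ (i, k) * (w $ (i, k) - w $ (j, k)))
        + A $ i $ j * (v $ (j, k) * (w $ (j, k) - w $ (i, k))))"
      by (simp add: T_def sum.distrib)
    also have "\<dots> = (\<Sum>i\<in>UNIV. \<Sum>j\<in>UNIV.
        A $ i $ j * ((v $ (i, k) - v $ (j, k)) * (w $ (i, k) - w $ (j, k))))"
      by (intro sum.cong refl) (simp add: algebra_simps)
    finally show ?thesis by simp
  qed
  then show ?thesis by (simp add: vT sum_distrib_left)
qed

text \<open>The quadratic form is a sum of nonnegative terms, so each vanishes and neighbours agree;
  connectivity carries the agreement along paths.\<close>

lemma laplacian_kernel: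
  fixes w :: "real ^ ('i::finite \<times> 'm::finite)"
  assumes graph: "undirected_weighted_graph A" "connected_graph A"
    and w: "kron_id (laplacian A) *v w = 0"
  shows "\<exists>\<nu>. w = stack (\<lambda>_. \<nu>)"
proof -
  have sym: "\<And>i j. A $ i $ j = A $ j $ i" and nn: "\<And>i j. 0 \<le> A $ i $ j"
    using graph(1) by (auto simp: undirected_weighted_graph_def)
  have "(\<Sum>k\<in>UNIV. \<Sum>i\<in>UNIV. \<Sum>j\<in>UNIV.
      A $ i $ j * ((w $ (i, k) - w $ (j, k)) * (w $ (i, k) - w $ (j, k)))) = 0"
    using laplacian_form[OF sym, where v = w and w = w] w by simp
  then have "A $ i $ j * ((w $ (i, k) - w $ (j, k)) * (w $ (i, k) - w $ (j, k))) = 0" for i j k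
    using nn by (simp add: sum_nonneg_eq_0_iff sum_nonneg)
  then have edge: "w $ (i, k) = w $ (j, k)" if "0 < A $ i $ j" for i j k
    using that by (metis less_irrefl mult_eq_0_iff right_minus_eq)
  have path: "w $ (i, k) = w $ (j, k)" for i j k
  proof -
    have "(i, j) \<in> {(a, b). 0 < A $ a $ b}\<^sup>*" using graph(2) by (simp add: connected_graph_def)
    then show ?thesis by (induction rule: rtrancl_induct) (auto dest: edge[of _ _ k])
  qed
  then have "w = stack (\<lambda>_. \<chi> k. w $ (undefined, k))"
    by (auto simp: stack_def vec_eq_iff)
  then show ?thesis by blast
qed

lemma laplacian_consensus: "kron_id (laplacian A) *v stack (\<lambda>_. \<nu>) = 0"
  by (auto simp: vec_eq_iff laplacian_component stack_def)

lemma inner_stack: "stack (\<lambda>_. \<nu>) \<bullet> stack h = \<nu> \<bullet> (\<Sum>i\<in>UNIV. h i)"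
proof -
  have "stack (\<lambda>_. \<nu>) \<bullet> stack h = (\<Sum>i\<in>UNIV. \<nu> \<bullet> h i)"
    by (simp add: inner_vec_def stack_def sum.cartesian_product split_def)
  then show ?thesis by (simp add: inner_sum_right)
qed

lemma transpose_block_diag_consensus:
  "transpose (block_diag own G) *v stack (\<lambda>_. \<nu>) = transpose G *v \<nu>"
proof -
  have "(\<Sum>p\<in>UNIV. block_diag own G $ p $ c * \<nu> $ snd p)
      = (\<Sum>k\<in>UNIV. \<Sum>i\<in>UNIV. if i = own c then G $ k $ c * \<nu> $ k else 0)" for c
    by (subst sum.swap) (auto simp: block_diag_def sum.cartesian_product intro!: sum.cong)
  then show ?thesis
    by (simp add: vec_eq_iff matrix_vector_mult_def transpose_def stack_def)
qed

lemma inner_block_diag: "stack (\<lambda>_. \<nu>) \<bullet> (block_diag own G *v y) = \<nu> \<bullet> (G *v y)"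
  by (metis inner_transpose transpose_block_diag_consensus)

section \<open>The seeking law\<close>

lemma inner_vec_nonneg: "0 \<le> a \<Longrightarrow> 0 \<le> b \<Longrightarrow> 0 \<le> a \<bullet> b" for a b :: "real ^ 'n"
  unfolding inner_vec_def by (intro sum_nonneg) (auto simp: less_eq_vec_def)

text \<open>The gradient of \<open>multiplier_cost\<close> in \<open>l\<close>, provided that
  \<open>L\<close> is symmetric.\<close>

definition multiplier_gradient ::
    "real ^ 'n ^ 'p \<Rightarrow> real ^ 'p ^ 'p \<Rightarrow> real ^ 'p \<Rightarrow> real \<Rightarrow> (real ^ 'n \<Rightarrow> real ^ 'n) \<Rightarrow>
     real ^ 'n \<Rightarrow> real ^ 'p \<Rightarrow> real ^ 'p \<Rightarrow> real ^ 'p" where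
  "multiplier_gradient Gd L Hs a F \<zeta> z l =
     Gd *v (transpose Gd *v l) + (Gd *v F \<zeta> - a *\<^sub>R (Gd *v \<zeta> - Hs) + L *v z) + L *v l"

lemma multiplier_cost_line:
  fixes L :: "real ^ 'p ^ 'p"
  assumes sym: "\<And>v w. v \<bullet> (L *v w) = w \<bullet> (L *v v)"
  shows "multiplier_cost Gd L Hs a F \<zeta> z (l + t *\<^sub>R d) = multiplier_cost Gd L Hs a F \<zeta> z l
    + t * (d \<bullet> multiplier_gradient Gd L Hs a F \<zeta> z l)
    + t\<^sup>2 * (1 / 2 * ((norm (transpose Gd *v d))\<^sup>2 + d \<bullet> (L *v d)))"
proof -
  define b where "b = Gd *v F \<zeta> - a *\<^sub>R (Gd *v \<zeta> - Hs) + L *v z"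
  have lin: "M *v (l + t *\<^sub>R d) = M *v l + t *\<^sub>R (M *v d)" for M :: "real ^ 'p ^ 'k"
    by (simp add: matrix_vector_right_distrib matrix_vector_mult_scaleR)
  have "(norm (transpose Gd *v l + t *\<^sub>R (transpose Gd *v d)))\<^sup>2
      = (norm (transpose Gd *v l))\<^sup>2 + 2 * t * (d \<bullet> (Gd *v (transpose Gd *v l)))
        + t\<^sup>2 * (norm (transpose Gd *v d))\<^sup>2"
    unfolding power2_norm_eq_inner inner_transpose[of Gd d, symmetric]
    by (simp add: inner_add_left inner_add_right inner_commute power2_eq_square algebra_simps
        del: transpose_matrix_vector)
  moreover have "(l + t *\<^sub>R d) \<bullet> (L *v l + t *\<^sub>R (L *v d))
      = l \<bullet> (L *v l) + 2 * t * (d \<bullet> (L *v l)) + t\<^sup>2 * (d \<bullet> (L *v d))"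
    using sym[of l d] by (simp add: inner_add_left inner_add_right power2_eq_square algebra_simps)
  ultimately show ?thesis
    unfolding multiplier_cost_def multiplier_gradient_def lin b_def[symmetric]
    by (simp add: inner_add_left inner_add_right algebra_simps del: transpose_matrix_vector)
qed

text \<open>If the directional derivative \<open>s\<close> towards \<open>v\<close> were negative, a
  short step along the segment, which stays in the orthant, would lower the cost.\<close>

lemma multiplier_argmin_VI:
  fixes L :: "real ^ 'p ^ 'p"
  assumes sym: "\<And>v w. v \<bullet> (L *v w) = w \<bullet> (L *v v)"
    and l: "is_arg_min (multiplier_cost Gd L Hs a F \<zeta> z) (\<lambda>v. 0 \<le> v) l" and v: "0 \<le> v"
  shows "0 \<le> (v - l) \<bullet> multiplier_gradient Gd L Hs a F \<zeta> z l"
proof (rule ccontr)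
  define s where "s = (v - l) \<bullet> multiplier_gradient Gd L Hs a F \<zeta> z l"
  define Q where "Q = 1 / 2 * ((norm (transpose Gd *v (v - l)))\<^sup>2 + (v - l) \<bullet> (L *v (v - l)))"
  assume "\<not> ?thesis"
  then have s: "s < 0" by (simp add: s_def)
  have l0: "0 \<le> l" using l by (simp add: is_arg_min_def)
  \<comment> \<open>Short enough for the linear term to outweigh the quadratic one, and at most 1 to
    stay on the segment.\<close>
  define t where "t = min 1 (- s / (2 * (\<bar>Q\<bar> + 1)))"
  have t: "0 < t" "t \<le> 1" using s by (auto simp: t_def divide_simps)
  have "t \<le> - s / (2 * (\<bar>Q\<bar> + 1))" by (simp add: t_def)
  then have "t * (2 * (\<bar>Q\<bar> + 1)) \<le> - s"
    by (subst (asm) pos_le_divide_eq) auto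
  then have "t * (\<bar>Q\<bar> + 1) \<le> - s / 2" by (simp add: algebra_simps)
  moreover have "t * Q \<le> t * (\<bar>Q\<bar> + 1)" using t by (intro mult_left_mono) auto
  ultimately have neg: "s + t * Q < 0" using s by linarith
  have "0 \<le> l + t *\<^sub>R (v - l)"
  proof -
    have "0 \<le> (1 - t) * l $ i + t * v $ i" for i
      using t l0 v by (intro add_nonneg_nonneg mult_nonneg_nonneg) (auto simp: less_eq_vec_def)
    then show ?thesis by (simp add: less_eq_vec_def algebra_simps)
  qed
  then have "multiplier_cost Gd L Hs a F \<zeta> z l \<le> multiplier_cost Gd L Hs a F \<zeta> z (l + t *\<^sub>R (v - l))"
    using l by (auto simp: is_arg_min_linorder)
  then have "0 \<le> t * s + t\<^sup>2 * Q"
    unfolding multiplier_cost_line[OF sym] s_def Q_def by simp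
  then have "0 \<le> t * (s + t * Q)" by (simp add: power2_eq_square algebra_simps)
  then show False using t neg by (simp add: zero_le_mult_iff)
qed

section \<open>The Lyapunov estimate for the seeking law\<close>

lemma coupling_form_bound:
  fixes a \<mu> \<theta> x y :: real
  assumes "0 < \<mu>" "\<theta>\<^sup>2 / (4 * \<mu>) < a"
  shows "(a * \<mu> - \<theta>\<^sup>2 / 4) / (a * \<mu> + 1) * (x\<^sup>2 + y\<^sup>2) \<le> a * \<mu> * x\<^sup>2 + y\<^sup>2 - \<theta> * x * y"
    and "0 < (a * \<mu> - \<theta>\<^sup>2 / 4) / (a * \<mu> + 1)"
proof -
  have d: "0 < a * \<mu> - \<theta>\<^sup>2 / 4" using assms by (simp add: divide_simps mult.commute mult.left_commute)
  then have p: "0 < a * \<mu> + 1" by (smt (verit) zero_le_power2 divide_nonneg_pos)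
  \<comment> \<open>Cayley-Hamilton for the matrix of the quadratic form, with trace
    \<open>a * \<mu> + 1\<close> and determinant \<open>a * \<mu> - \<theta>\<^sup>2 / 4\<close>;
    the right side is the squared norm of the image of \<open>(x, y)\<close>. Determinant over trace
    thus bounds the smallest eigenvalue from below.\<close>
  have "(a * \<mu> + 1) * (a * \<mu> * x\<^sup>2 + y\<^sup>2 - \<theta> * x * y) - (a * \<mu> - \<theta>\<^sup>2 / 4) * (x\<^sup>2 + y\<^sup>2)
      = (a * \<mu> * x - \<theta> / 2 * y)\<^sup>2 + (y - \<theta> / 2 * x)\<^sup>2"
    by (simp add: power2_eq_square algebra_simps)
  then have "(a * \<mu> - \<theta>\<^sup>2 / 4) * (x\<^sup>2 + y\<^sup>2) \<le> (a * \<mu> * x\<^sup>2 + y\<^sup>2 - \<theta> * x * y) * (a * \<mu> + 1)"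
    by (smt (verit) zero_le_power2 mult.commute)
  then show "(a * \<mu> - \<theta>\<^sup>2 / 4) / (a * \<mu> + 1) * (x\<^sup>2 + y\<^sup>2) \<le> a * \<mu> * x\<^sup>2 + y\<^sup>2 - \<theta> * x * y"
    using p by (simp add: pos_divide_le_eq)
  show "0 < (a * \<mu> - \<theta>\<^sup>2 / 4) / (a * \<mu> + 1)" using d p by simp
qed

text \<open>The indefinite terms \<open>- a * (P \<bullet> e) + q \<bullet> (L *v p)\<close> in the
  derivative of the Lyapunov function are those of the monotonicity inequality \<open>key\<close>,
  which explains the weight \<open>a\<close> on the squared error. The Lipschitz bound on
  \<open>P \<bullet> D\<close> leaves the form of \<open>coupling_form_bound\<close>.\<close>

lemma seeking_dissipation:
  fixes Gd :: "real ^ 'n ^ 'p" and L :: "real ^ 'p ^ 'p"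
  assumes sym: "\<And>v w. v \<bullet> (L *v w) = w \<bullet> (L *v v)" and psd: "\<And>v. 0 \<le> v \<bullet> (L *v v)"
    and F: "strongly_monotone \<mu> F" "\<theta>-lipschitz_on UNIV F"
    and \<mu>: "0 < \<mu>" and a: "\<theta>\<^sup>2 / (4 * \<mu>) < a"
    and eq: "transpose Gd *v l' = - F \<zeta>'" "L *v l' = 0"
    and mon: "(l - l') \<bullet> (multiplier_gradient Gd L Hs a F \<zeta> z l
        - multiplier_gradient Gd L Hs a F \<zeta>' z' l') \<le> 0"
    and u: "u = - F \<zeta> - transpose Gd *v l"
    and S: "S = (norm (\<zeta> - \<zeta>'))\<^sup>2 + (norm (transpose Gd *v (l - l')))\<^sup>2"
  shows "a * ((\<zeta> - \<zeta>') \<bullet> u) + (z - z') \<bullet> (L *v l)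
      \<le> - ((a * \<mu> - \<theta>\<^sup>2 / 4) / (a * \<mu> + 1)) * S"
    and "2 * ((\<zeta> - \<zeta>') \<bullet> u) \<le> S"
proof -
  define e where "e = \<zeta> - \<zeta>'"
  define p where "p = l - l'"
  define q where "q = z - z'"
  define P where "P = transpose Gd *v p"
  define D where "D = F \<zeta> - F \<zeta>'"
  have a0: "0 < a" using a \<mu> by (smt (verit) zero_le_power2 divide_nonneg_pos)
  have uDP: "u = - D - P"
    using eq by (simp add: u D_def P_def p_def matrix_vector_mult_diff_distrib del: transpose_matrix_vector)
  have Ll: "L *v l = L *v p" using eq by (simp add: p_def matrix_vector_mult_diff_distrib)
  have "multiplier_gradient Gd L Hs a F \<zeta> z l - multiplier_gradient Gd L Hs a F \<zeta>' z' l'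
      = Gd *v P + Gd *v D - a *\<^sub>R (Gd *v e) + L *v q + L *v p"
    by (simp add: multiplier_gradient_def P_def D_def e_def q_def p_def
        matrix_vector_mult_diff_distrib algebra_simps del: transpose_matrix_vector)
  then have "p \<bullet> (Gd *v P) + p \<bullet> (Gd *v D) - a * (p \<bullet> (Gd *v e)) + p \<bullet> (L *v q) + p \<bullet> (L *v p) \<le> 0"
    using mon by (simp add: p_def[symmetric] inner_add_right inner_diff_right)
  then have key: "P \<bullet> P + P \<bullet> D - a * (P \<bullet> e) + q \<bullet> (L *v p) + p \<bullet> (L *v p) \<le> 0"
    unfolding sym[of q p] unfolding inner_transpose[of Gd p, symmetric] P_def .
  have eD: "\<mu> * (norm e)\<^sup>2 \<le> e \<bullet> D"
    using F(1) by (simp add: strongly_monotone_def e_def D_def inner_commute)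
  have "norm D \<le> \<theta> * norm e" using F(2) by (auto simp: lipschitz_on_def dist_norm e_def D_def)
  then have PD: "- (P \<bullet> D) \<le> \<theta> * norm e * norm P"
    using norm_cauchy_schwarz[of "- P" D] mult_left_mono[of "norm D" "\<theta> * norm e" "norm P"]
    by (simp add: mult.commute)
  have Sep: "S = (norm e)\<^sup>2 + (norm P)\<^sup>2" by (simp add: S e_def P_def p_def del: transpose_matrix_vector)
  have "a * (e \<bullet> u) + q \<bullet> (L *v l) = - a * (e \<bullet> D) - a * (P \<bullet> e) + q \<bullet> (L *v p)"
    by (simp add: uDP Ll inner_diff_right inner_commute algebra_simps)
  also have "\<dots> \<le> - (a * (\<mu> * (norm e)\<^sup>2)) - (norm P)\<^sup>2 + \<theta> * norm e * norm P"
    using key psd[of p] PD mult_left_mono[OF eD less_imp_le[OF a0]]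
    by (simp add: power2_norm_eq_inner)
  also have "\<dots> \<le> - ((a * \<mu> - \<theta>\<^sup>2 / 4) / (a * \<mu> + 1)) * S"
    using coupling_form_bound(1)[OF \<mu> a, of "norm e" "norm P"] by (simp add: Sep)
  finally show "a * ((\<zeta> - \<zeta>') \<bullet> u) + (z - z') \<bullet> (L *v l)
      \<le> - ((a * \<mu> - \<theta>\<^sup>2 / 4) / (a * \<mu> + 1)) * S"
    by (simp add: e_def q_def)
  have "2 * (e \<bullet> u) \<le> - (2 * (e \<bullet> P))"
    using order_trans[OF _ eD, of 0] \<mu> by (simp add: uDP inner_diff_right)
  also have "\<dots> \<le> S"
    using inner_ge_zero[of "e + P"]
    by (simp add: Sep power2_norm_eq_inner inner_add_left inner_add_right inner_commute)
  finally show "2 * ((\<zeta> - \<zeta>') \<bullet> u) \<le> S" by (simp add: e_def)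
qed

lemma seeking_tendsto:
  fixes Gd :: "real ^ 'n ^ 'p" and L :: "real ^ 'p ^ 'p"
  assumes sym: "\<And>v w. v \<bullet> (L *v w) = w \<bullet> (L *v v)" and psd: "\<And>v. 0 \<le> v \<bullet> (L *v v)"
    and F: "strongly_monotone \<mu> F" "\<theta>-lipschitz_on UNIV F"
    and \<mu>: "0 < \<mu>" and a: "\<theta>\<^sup>2 / (4 * \<mu>) < a"
    and eq: "transpose Gd *v l' = - F \<zeta>'" "L *v l' = 0" "0 \<le> l'"
      "0 \<le> multiplier_gradient Gd L Hs a F \<zeta>' z' l'"
      "l' \<bullet> multiplier_gradient Gd L Hs a F \<zeta>' z' l' = 0"
    and zeta_ode: "\<And>t. 0 \<le> t \<Longrightarrow> (\<zeta> has_vector_derivative u t) (at t within {0..})"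
    and u_eq: "\<And>t. 0 \<le> t \<Longrightarrow> u t = - F (\<zeta> t) - transpose Gd *v l t"
    and z_ode: "\<And>t. 0 \<le> t \<Longrightarrow> (z has_vector_derivative L *v l t) (at t within {0..})"
    and l_argmin: "\<And>t. 0 \<le> t \<Longrightarrow>
       is_arg_min (multiplier_cost Gd L Hs a F (\<zeta> t) (z t)) (\<lambda>v. 0 \<le> v) (l t)"
  shows "(\<zeta> \<longlongrightarrow> \<zeta>') at_top"
proof -
  define c where "c = (a * \<mu> - \<theta>\<^sup>2 / 4) / (a * \<mu> + 1)"
  have c: "0 < c" unfolding c_def by (rule coupling_form_bound(2)[OF \<mu> a])
  have a0: "0 < a" using a \<mu> by (smt (verit) zero_le_power2 divide_nonneg_pos)
  define S where "S t = (norm (\<zeta> t - \<zeta>'))\<^sup>2 + (norm (transpose Gd *v (l t - l')))\<^sup>2" for t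
  \<comment> \<open>Two tests combined: the minimiser at time \<open>t\<close> against
    \<open>l'\<close>, and the equilibrium gradient against \<open>l t\<close>, with complementarity
    removing the term in \<open>l'\<close>.\<close>
  have mon: "(l t - l') \<bullet> (multiplier_gradient Gd L Hs a F (\<zeta> t) (z t) (l t)
        - multiplier_gradient Gd L Hs a F \<zeta>' z' l') \<le> 0" if t: "0 \<le> t" for t
  proof -
    have "0 \<le> (l' - l t) \<bullet> multiplier_gradient Gd L Hs a F (\<zeta> t) (z t) (l t)"
      using multiplier_argmin_VI[OF sym l_argmin[OF t] eq(3)] .
    moreover have "0 \<le> l t \<bullet> multiplier_gradient Gd L Hs a F \<zeta>' z' l'"
      using l_argmin[OF t] eq(4) by (intro inner_vec_nonneg) (auto simp: is_arg_min_def)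
    ultimately show ?thesis
      using eq(5) by (simp add: inner_diff_left inner_diff_right)
  qed
  note diss = seeking_dissipation[OF sym psd F \<mu> a eq(1,2) mon u_eq S_def, folded c_def]
  have err: "((\<lambda>t. \<zeta> t - \<zeta>') has_vector_derivative u t) (at t within {0..})"
    "((\<lambda>t. z t - z') has_vector_derivative L *v l t) (at t within {0..})" if "0 \<le> t" for t
    using has_vector_derivative_diff[OF zeta_ode[OF that] has_vector_derivative_const]
      has_vector_derivative_diff[OF z_ode[OF that] has_vector_derivative_const] by simp_all
  have sq: "((\<lambda>t. f t \<bullet> f t) has_vector_derivative 2 * (f t \<bullet> f')) (at t within {0..})"
    if "(f has_vector_derivative f') (at t within {0..})"
    for f :: "real \<Rightarrow> real ^ 'k" and f' t
    using bounded_bilinear.has_vector_derivative[OF bounded_bilinear_inner that that]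
    by (simp add: inner_commute)
  have "((\<lambda>t. (\<zeta> t - \<zeta>') \<bullet> (\<zeta> t - \<zeta>')) \<longlongrightarrow> 0) at_top"
  \<comment> \<open>The squared error grows at most at rate \<open>S t\<close>, and
    \<open>S t\<close> is at most \<open>1 / c\<close> times the decay rate of \<open>V\<close>;
    this fixes \<open>k\<close>.\<close>
  proof (rule dissipation_tendsto_0[where c = c and k = "1 / c"
        and V = "\<lambda>t. a / 2 * ((\<zeta> t - \<zeta>') \<bullet> (\<zeta> t - \<zeta>')) + 1 / 2 * ((z t - z') \<bullet> (z t - z'))"
        and V' = "\<lambda>t. a * ((\<zeta> t - \<zeta>') \<bullet> u t) + (z t - z') \<bullet> (L *v l t)"
        and E' = "\<lambda>t. 2 * ((\<zeta> t - \<zeta>') \<bullet> u t)"])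
    fix t :: real assume t: "0 \<le> t"
    show "((\<lambda>t. (\<zeta> t - \<zeta>') \<bullet> (\<zeta> t - \<zeta>')) has_vector_derivative 2 * ((\<zeta> t - \<zeta>') \<bullet> u t))
        (at t within {0..})"
      by (rule sq[OF err(1)[OF t]])
    have "((\<lambda>t. a / 2 * ((\<zeta> t - \<zeta>') \<bullet> (\<zeta> t - \<zeta>')) + 1 / 2 * ((z t - z') \<bullet> (z t - z')))
        has_vector_derivative
          a / 2 * (2 * ((\<zeta> t - \<zeta>') \<bullet> u t)) + 1 / 2 * (2 * ((z t - z') \<bullet> (L *v l t))))
        (at t within {0..})"
      by (intro has_vector_derivative_add has_vector_derivative_mult_right sq[OF err(1)[OF t]]
          sq[OF err(2)[OF t]])
    then show "((\<lambda>t. a / 2 * ((\<zeta> t - \<zeta>') \<bullet> (\<zeta> t - \<zeta>')) + 1 / 2 * ((z t - z') \<bullet> (z t - z')))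
        has_vector_derivative (a * ((\<zeta> t - \<zeta>') \<bullet> u t) + (z t - z') \<bullet> (L *v l t))) (at t within {0..})"
      by simp
    have "c * ((\<zeta> t - \<zeta>') \<bullet> (\<zeta> t - \<zeta>')) \<le> c * S t"
      using c by (intro mult_left_mono) (auto simp: S_def power2_norm_eq_inner)
    then show "a * ((\<zeta> t - \<zeta>') \<bullet> u t) + (z t - z') \<bullet> (L *v l t)
        \<le> - c * ((\<zeta> t - \<zeta>') \<bullet> (\<zeta> t - \<zeta>'))"
      using diss(1)[OF t t] by simp
    have "S t \<le> - (1 / c) * (a * ((\<zeta> t - \<zeta>') \<bullet> u t) + (z t - z') \<bullet> (L *v l t))"
      using divide_right_mono[OF diss(1)[OF t t] less_imp_le[OF c]] c by simp
    then show "2 * ((\<zeta> t - \<zeta>') \<bullet> u t)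
        \<le> - (1 / c) * (a * ((\<zeta> t - \<zeta>') \<bullet> u t) + (z t - z') \<bullet> (L *v l t))"
      using diss(2)[OF t t] by linarith
    show "0 \<le> a / 2 * ((\<zeta> t - \<zeta>') \<bullet> (\<zeta> t - \<zeta>')) + 1 / 2 * ((z t - z') \<bullet> (z t - z'))"
      using a0 by (intro add_nonneg_nonneg mult_nonneg_nonneg inner_ge_zero) auto
    show "0 \<le> (\<zeta> t - \<zeta>') \<bullet> (\<zeta> t - \<zeta>')" by (rule inner_ge_zero)
  next
    show "0 < c" by (rule c)
    show "0 \<le> 1 / c" using c by simp
  qed
  from tendsto_real_sqrt[OF this] have "((\<lambda>t. norm (\<zeta> t - \<zeta>')) \<longlongrightarrow> 0) at_top"
    unfolding norm_eq_sqrt_inner real_sqrt_zero .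
  then show ?thesis by (rule LIM_zero_cancel[OF tendsto_norm_zero_cancel])
qed

text \<open>
  At equilibrium the slack of the shared constraint is split evenly among the players; \<open>z\<close> makes up
  for the difference between this share and the local slack \<open>h\<^sub>i - g\<^sub>i x\<^sub>i\<close>.
\<close>

lemma seeking_equilibrium:
  fixes own :: "'n::finite \<Rightarrow> 'i::finite" and G :: "real ^ 'n ^ 'm::finite" and h :: "'i \<Rightarrow> real ^ 'm"
    and Adj :: "real ^ 'i ^ 'i"
  defines "H \<equiv> \<Sum>i\<in>UNIV. h i" and "L \<equiv> kron_id (laplacian Adj) :: real ^ ('i \<times> 'm) ^ ('i \<times> 'm)"
    and "Gd \<equiv> block_diag own G"
  assumes rank: "rank G = CARD('m)" and VI: "VI_solution (feasible_set G H) F x"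
    and graph: "undirected_weighted_graph Adj" "connected_graph Adj" and a: "0 \<le> a"
  shows "\<exists>z l. transpose Gd *v l = - F x \<and> L *v l = 0 \<and> 0 \<le> l
    \<and> 0 \<le> multiplier_gradient Gd L (stack h) a F x z l
    \<and> l \<bullet> multiplier_gradient Gd L (stack h) a F x z l = 0"
proof -
  have sym: "\<And>i j. Adj $ i $ j = Adj $ j $ i" using graph(1) by (simp add: undirected_weighted_graph_def)
  have L_sym: "v \<bullet> (L *v w) = w \<bullet> (L *v v)" for v w
    unfolding L_def laplacian_form[OF sym] by (simp add: mult.commute mult.left_commute)
  obtain \<nu> where \<nu>: "0 \<le> \<nu>" "F x + transpose G *v \<nu> = 0" "\<nu> \<bullet> (H - G *v x) = 0"
    using VI_multiplier[OF rank VI] by blast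
  define l :: "real ^ ('i \<times> 'm)" where "l = stack (\<lambda>_. \<nu>)"
  \<comment> \<open>One player's share of the slack, scaled by \<open>a\<close>; it becomes every
    player's block of the multiplier gradient.\<close>
  define s where "s = (a / real CARD('i)) *\<^sub>R (H - G *v x)"
  have inner_s: "stack (\<lambda>_. \<nu>') \<bullet> stack (\<lambda>_ :: 'i. s) = a * (\<nu>' \<bullet> (H - G *v x))" for \<nu>'
    by (simp add: inner_stack s_def sum_constant_scaleR del: sum_constant)
  \<comment> \<open>Solvability is tested on consensus vectors, the kernel of \<open>L\<close>:
    there the shares add up to \<open>a\<close> times the slack and cancel the sum of the local
    terms.\<close>
  have "\<exists>z. L *v z = stack (\<lambda>_. s) + a *\<^sub>R (Gd *v x - stack h)"
  proof (rule range_matrix_vector)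
    fix r assume r: "transpose L *v r = 0"
    have "(L *v r) \<bullet> w = 0" for w
      using inner_transpose[of L r w] L_sym[of r w] unfolding r by (simp add: inner_commute)
    then have "L *v r = 0" by (metis inner_eq_zero_iff)
    then obtain \<nu>' where "r = stack (\<lambda>_. \<nu>')" using laplacian_kernel[OF graph] unfolding L_def by blast
    then show "r \<bullet> (stack (\<lambda>_. s) + a *\<^sub>R (Gd *v x - stack h)) = 0"
      by (simp add: inner_add_right inner_diff_right inner_s inner_stack inner_block_diag Gd_def
          H_def[symmetric] algebra_simps)
  qed
  then obtain z where z: "L *v z = stack (\<lambda>_. s) + a *\<^sub>R (Gd *v x - stack h)" by blast
  have Gl: "transpose Gd *v l = - F x"
    unfolding Gd_def l_def transpose_block_diag_consensus using \<nu>(2) by (metis add_eq_0_iff)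
  have Ll: "L *v l = 0" unfolding L_def l_def by (rule laplacian_consensus)
  have grad: "multiplier_gradient Gd L (stack h) a F x z l = stack (\<lambda>_. s)"
    unfolding multiplier_gradient_def Gl Ll z
    by (simp add: linear_neg[OF matrix_vector_mul_linear])
  have "0 \<le> H - G *v x" using VI by (auto simp: VI_solution_def feasible_iff less_eq_vec_def)
  then have "0 \<le> s" using a by (auto simp: s_def less_eq_vec_def)
  then show ?thesis
    using Gl Ll grad \<nu> inner_s[of \<nu>]
    by (intro exI[of _ z] exI[of _ l]) (auto simp: l_def stack_def less_eq_vec_def)
qed

text \<open>Comparison row by row. Only the sign of the rate where a constraint is active or
  violated enters, so the lemma serves both the seeking law and each lag of the chain.\<close>

lemma feasible_lag_invariant:
  assumes der: "\<And>t. 0 \<le> t \<Longrightarrow> (w has_vector_derivative w' t) (at t within {0..})"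
    and lag: "\<And>t k. 0 \<le> t \<Longrightarrow> H $ k \<le> (G *v w t) $ k \<Longrightarrow> (G *v w' t) $ k \<le> 0"
    and w0: "w 0 \<in> feasible_set G H" and t: "0 \<le> t"
  shows "w t \<in> feasible_set G H"
  unfolding feasible_iff
proof
  fix k
  have "(G *v w t) $ k - H $ k \<le> 0"
  proof (rule nonpos_of_derivative[where g = "\<lambda>t. (G *v w t) $ k - H $ k" and g' = "\<lambda>t. (G *v w' t) $ k"])
    fix s :: real assume s: "0 \<le> s"
    have "bounded_linear (\<lambda>v. (G *v v) $ k)"
      by (simp add: matrix_vector_mul_component bounded_linear_inner_right)
    then have "((\<lambda>t. (G *v w t) $ k) has_vector_derivative (G *v w' s) $ k) (at s within {0..})"
      by (rule bounded_linear.has_vector_derivative[OF _ der[OF s]])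
    then show "((\<lambda>t. (G *v w t) $ k - H $ k) has_vector_derivative (G *v w' s) $ k) (at s within {0..})"
      by (auto intro!: derivative_eq_intros)
    show "0 \<le> (G *v w s) $ k - H $ k \<Longrightarrow> (G *v w' s) $ k \<le> 0"
      using lag[OF s, of k] by simp
  next
    show "(G *v w 0) $ k - H $ k \<le> 0" using w0 by (simp add: feasible_iff)
  qed (rule t)
  then show "(G *v w t) $ k \<le> H $ k" by simp
qed

lemma seeking_barrier:
  fixes own :: "'n::finite \<Rightarrow> 'i::finite" and G :: "real ^ 'n ^ 'm::finite" and h :: "'i \<Rightarrow> real ^ 'm"
    and Adj :: "real ^ 'i ^ 'i"
  defines "H \<equiv> \<Sum>i\<in>UNIV. h i" and "L \<equiv> kron_id (laplacian Adj) :: real ^ ('i \<times> 'm) ^ ('i \<times> 'm)"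
    and "Gd \<equiv> block_diag own G"
  assumes graph: "undirected_weighted_graph Adj"
    and l: "is_arg_min (multiplier_cost Gd L (stack h) a F \<zeta> z) (\<lambda>v. 0 \<le> v) l"
    and u: "u = - F \<zeta> - transpose Gd *v l"
  shows "(G *v u) $ k \<le> - a * ((G *v \<zeta>) $ k - H $ k)"
proof -
  have sym: "\<And>i j. Adj $ i $ j = Adj $ j $ i" using graph by (simp add: undirected_weighted_graph_def)
  have L_sym: "v \<bullet> (L *v w) = w \<bullet> (L *v v)" for v w
    unfolding L_def laplacian_form[OF sym] by (simp add: mult.commute mult.left_commute)
  \<comment> \<open>The unit vector of constraint \<open>k\<close> for every player at once:
    \<open>L\<close> annihilates it, and it adds the local rows up to row \<open>k\<close> of
    \<open>G\<close>.\<close>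
  define e :: "real ^ ('i \<times> 'm)" where "e = stack (\<lambda>_. axis k 1)"
  have "0 \<le> e" by (simp add: e_def stack_def less_eq_vec_def axis_def)
  then have "0 \<le> l + e" using l by (simp add: is_arg_min_def)
  from multiplier_argmin_VI[OF L_sym l this]
  have "0 \<le> e \<bullet> multiplier_gradient Gd L (stack h) a F \<zeta> z l" by simp
  also have "multiplier_gradient Gd L (stack h) a F \<zeta> z l
      = - (Gd *v u) - a *\<^sub>R (Gd *v \<zeta> - stack h) + L *v (z + l)"
    by (simp add: multiplier_gradient_def u matrix_vector_mult_diff_distrib
        matrix_vector_right_distrib linear_neg[OF matrix_vector_mul_linear] del: transpose_matrix_vector)
  also have "e \<bullet> \<dots> = - (axis k 1 \<bullet> (G *v u)) - a * (axis k 1 \<bullet> (G *v \<zeta>) - axis k 1 \<bullet> H)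
      + e \<bullet> (L *v (z + l))"
    by (simp add: inner_add_right inner_diff_right e_def inner_stack inner_block_diag Gd_def H_def
        inner_minus_right)
  also have "e \<bullet> (L *v (z + l)) = 0"
    unfolding L_sym[of e] by (simp add: e_def L_def laplacian_consensus)
  finally show ?thesis by (simp add: inner_axis' algebra_simps)
qed

section \<open>Lag equations along the closed loop\<close>

lemma stage_split: "stage \<alpha> q e = e 0 + (\<Sum>j\<in>{1..q}. delta \<alpha> q j *\<^sub>R e j)"
proof -
  have "{..q} = insert 0 {1..q}" by auto
  then show ?thesis by (simp add: stage_def)
qed

lemma zeta_coord_derivative:
  assumes \<alpha>: "\<forall>k\<in>{1..q}. 0 < \<alpha> k"
    and zeta_ode: "\<And>t. 0 \<le> t \<Longrightarrow> (\<zeta> has_vector_derivative u t) (at t within {0..})"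
    and xd_ode: "\<And>t k. 0 \<le> t \<Longrightarrow> k \<in> {1..q} \<Longrightarrow>
       (xd k has_vector_derivative derivative_field \<alpha> q k (\<lambda>j. xd j t) (u t)) (at t within {0..})"
    and x_eq: "\<And>t. 0 \<le> t \<Longrightarrow> x t = \<zeta> t - (\<Sum>j\<in>{1..q}. delta \<alpha> q j *\<^sub>R xd j t)"
    and k: "k < q" and t: "0 \<le> t"
  shows "((\<lambda>t. zeta_coord \<alpha> k (x t) (\<lambda>j. xd j t)) has_vector_derivative
      \<alpha> (Suc k) *\<^sub>R (zeta_coord \<alpha> (Suc k) (x t) (\<lambda>j. xd j t) - zeta_coord \<alpha> k (x t) (\<lambda>j. xd j t)))
      (at t within {0..})"
proof -
  define f where "f = chain_field \<alpha> q (\<lambda>j. xd j t) (u t)"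
  have xd': "(xd j has_vector_derivative f j) (at t within {0..})" if "j \<in> {1..q}" for j
    using xd_ode[OF t that] by (simp only: f_def derivative_field_eq_chain_field[OF that])
  have scale: "((\<lambda>t. c *\<^sub>R g t) has_vector_derivative c *\<^sub>R g') (at t within {0..})"
    if "(g has_vector_derivative g') (at t within {0..})" for c :: real and g :: "real \<Rightarrow> real ^ 'n" and g'
    by (rule bounded_linear.has_vector_derivative[OF bounded_linear_scaleR_right that])
  have "((\<lambda>t. \<zeta> t - (\<Sum>j\<in>{1..q}. delta \<alpha> q j *\<^sub>R xd j t)) has_vector_derivative
      u t - (\<Sum>j\<in>{1..q}. delta \<alpha> q j *\<^sub>R f j)) (at t within {0..})"
    by (intro has_vector_derivative_diff has_vector_derivative_sum zeta_ode t scale xd')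
  \<comment> \<open>This identifies the velocity of \<open>x\<close>, which is only given
    algebraically, with the first derivative block; \<open>k < q\<close> ensures that there is
    one.\<close>
  moreover have "u t - (\<Sum>j\<in>{1..q}. delta \<alpha> q j *\<^sub>R f j) = f 0"
    using stage_chain_field[OF \<alpha>, of "\<lambda>j. xd j t" "u t"] k
    by (simp add: f_def[symmetric] stage_split algebra_simps)
  ultimately have x': "(x has_vector_derivative f 0) (at t within {0..})"
    using x_eq t by (auto intro: has_vector_derivative_transform[of t "{0..}"])
  have "((\<lambda>t. stage \<alpha> k (\<lambda>j. if j = 0 then x t else xd j t)) has_vector_derivative stage \<alpha> k f)
      (at t within {0..})"
    unfolding stage_def
  proof (intro has_vector_derivative_sum scale)
    fix j assume "j \<in> {..k}"
    then show "((\<lambda>t. if j = 0 then x t else xd j t) has_vector_derivative f j) (at t within {0..})"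
      using x' xd'[of j] k by (cases "j = 0") auto
  qed
  moreover have "stage \<alpha> k f = stage \<alpha> k (\<lambda>j. if Suc j = 0 then x t else xd (Suc j) t)"
    using k by (intro stage_cong) (simp add: f_def chain_field_def)
  moreover have "\<alpha> (Suc k) \<noteq> 0" using \<alpha> k by (auto simp: less_le)
  ultimately show ?thesis
    unfolding zeta_coord_eq_stage
    using stage_shift[of \<alpha> k "\<lambda>j. if j = 0 then x t else xd j t"] by simp
qed

section \<open>The closed loop\<close>

theorem theorem5p4:
  fixes own :: "'n::finite \<Rightarrow> 'i::finite"
    and J :: "'i \<Rightarrow> real ^ 'n \<Rightarrow> real"
    and G :: "real ^ 'n ^ 'm::finite"
    and h :: "'i \<Rightarrow> real ^ 'm"
    and H :: "real ^ 'm"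
    and Adj :: "real ^ 'i ^ 'i"
    and Gd :: "real ^ 'n ^ ('i \<times> 'm)"
    and Hs :: "real ^ ('i \<times> 'm)"
    and L :: "real ^ ('i \<times> 'm) ^ ('i \<times> 'm)"
    and F :: "real ^ 'n \<Rightarrow> real ^ 'n"
    and X Z :: "(real ^ 'n) set"
    and \<mu> \<theta> :: real
    and r :: nat
    and \<alpha> :: "nat \<Rightarrow> real"
    and \<zeta> u x :: "real \<Rightarrow> real ^ 'n"
    and z l :: "real \<Rightarrow> real ^ ('i \<times> 'm)"
    and xd :: "nat \<Rightarrow> real \<Rightarrow> real ^ 'n"
  assumes H_def: "H = (\<Sum>i\<in>UNIV. h i)"
    and Gd_def: "Gd = block_diag own G"
    and Hs_def: "Hs = stack h"
    and L_def: "L = kron_id (laplacian Adj)"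
    and F_def: "F = pseudo_gradient own J"
    and X_def: "X = feasible_set G H"
    and Z_def: "Z = transformed_set G H"
    and J_C1: "\<And>i w. continuously_differentiable (\<lambda>y. J i (replace own i y w))"
    and J_convex: "\<And>i w. convex_on UNIV (\<lambda>y. J i (replace own i y w))"
    and slater: "slater G H"
    and full_row_rank: "rank G = CARD('m)"
    and mu_pos: "0 < \<mu>" and theta_pos: "0 < \<theta>"
    and F_monotone: "strongly_monotone \<mu> F"
    and F_lipschitz: "\<theta>-lipschitz_on UNIV F"
    and graph: "undirected_weighted_graph Adj" "connected_graph Adj"
    and r_pos: "1 \<le> r"
    and zeta_ode: "\<And>t. 0 \<le> t \<Longrightarrow> (\<zeta> has_vector_derivative u t) (at t within {0..})"
    and u_eq: "\<And>t. 0 \<le> t \<Longrightarrow> u t = - F (\<zeta> t) - transpose Gd *v l t"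
    and z_ode: "\<And>t. 0 \<le> t \<Longrightarrow> (z has_vector_derivative L *v l t) (at t within {0..})"
    and l_argmin: "\<And>t. 0 \<le> t \<Longrightarrow>
       is_arg_min (multiplier_cost Gd L Hs (\<alpha> r) F (\<zeta> t) (z t)) (\<lambda>v. 0 \<le> v) (l t)"
    and xd_ode: "\<And>t k. 0 \<le> t \<Longrightarrow> k \<in> {1..r - 1} \<Longrightarrow>
       (xd k has_vector_derivative derivative_field \<alpha> (r - 1) k (\<lambda>j. xd j t) (u t))
         (at t within {0..})"
    and x_eq: "\<And>t. 0 \<le> t \<Longrightarrow> x t = \<zeta> t - (\<Sum>j\<in>{1..r - 1}. delta \<alpha> (r - 1) j *\<^sub>R xd j t)"
    and x_init: "x 0 \<in> X"
  shows
    "(\<alpha> r > \<theta>\<^sup>2 / (4 * \<mu>) \<longrightarrow>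
        (\<exists>zs. (\<forall>y. transformed_v_GNE own J Z (r - 1) y \<longleftrightarrow> y = zs) \<and> (\<zeta> \<longlongrightarrow> zs) at_top) \<and>
        (\<zeta> 0 \<in> Z \<longrightarrow> (\<forall>t\<ge>0. \<zeta> t \<in> Z)))
     \<and>
     ((\<forall>k\<in>{1..r - 1}. \<alpha> k > 0) \<longrightarrow>
        ISS {1..r - 1}
          (derivative_field \<alpha> (r - 1) ::
             nat \<Rightarrow> (nat \<Rightarrow> real ^ 'n) \<Rightarrow> real ^ 'n \<Rightarrow> real ^ 'n))
     \<and>
     (\<alpha> r > \<theta>\<^sup>2 / (4 * \<mu>) \<and> (\<forall>k\<in>{1..r - 1}. \<alpha> k > 0) \<longrightarrow>
        (\<exists>xs. (\<forall>y. v_GNE own J X y \<longleftrightarrow> y = xs) \<and> (x \<longlongrightarrow> xs) at_top) \<and>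
        ((\<forall>k\<in>{1..r - 1}. zeta_coord \<alpha> k (x 0) (\<lambda>j. xd j 0) \<in> X) \<longrightarrow> (\<forall>t\<ge>0. x t \<in> X)))"
proof (intro conjI impI)
  define q where "q = r - 1"
  have X_eq: "X = feasible_set G H" "Z = X"
    by (simp_all add: X_def Z_def feasible_set_eq_transformed_set)
  have sym: "\<And>i j. Adj $ i $ j = Adj $ j $ i" and nn: "\<And>i j. 0 \<le> Adj $ i $ j"
    using graph(1) by (auto simp: undirected_weighted_graph_def)
  have L_sym: "v \<bullet> (L *v w) = w \<bullet> (L *v v)" for v w
    unfolding L_def laplacian_form[OF sym] by (simp add: mult.commute mult.left_commute)
  have L_psd: "0 \<le> v \<bullet> (L *v v)" for v
    unfolding L_def laplacian_form[OF sym] using nn by (simp add: sum_nonneg)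
  obtain w where "\<forall>k. (G *v w - H) $ k < 0" using slater by (auto simp: slater_def)
  then have "w \<in> X" by (auto simp: X_eq feasible_iff intro: less_imp_le)
  then have "X \<noteq> {}" by blast
  then obtain zs where zs: "VI_solution X F zs"
    using VI_exists[OF closed_feasible_set convex_feasible_set _ F_monotone F_lipschitz mu_pos theta_pos]
    unfolding X_eq by blast
  have zs_unique: "VI_solution X F y \<longleftrightarrow> y = zs" for y
    using zs VI_unique[OF F_monotone mu_pos] by blast
  have zs_GNE: "v_GNE own J X y \<longleftrightarrow> y = zs" for y
    using v_GNE_iff_VI[OF J_C1 J_convex] zs_unique by (simp add: F_def)
  have zs_transformed: "transformed_v_GNE own J Z (r - 1) y \<longleftrightarrow> y = zs" for y
    using transformed_v_GNE_iff_VI[OF J_C1 J_convex] zs_unique by (simp add: F_def X_eq)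
  have zeta_lim: "(\<zeta> \<longlongrightarrow> zs) at_top" and a_nonneg: "0 \<le> \<alpha> r" if a: "\<alpha> r > \<theta>\<^sup>2 / (4 * \<mu>)"
  proof -
    show a0: "0 \<le> \<alpha> r" using a mu_pos by (smt (verit) zero_le_power2 divide_nonneg_pos)
    obtain z' l' where eq: "transpose Gd *v l' = - F zs" "L *v l' = 0" "0 \<le> l'"
      "0 \<le> multiplier_gradient Gd L Hs (\<alpha> r) F zs z' l'"
      "l' \<bullet> multiplier_gradient Gd L Hs (\<alpha> r) F zs z' l' = 0"
      using seeking_equilibrium[OF full_row_rank zs[unfolded X_eq H_def] graph a0, of own]
      unfolding Gd_def L_def Hs_def by blast
    show "(\<zeta> \<longlongrightarrow> zs) at_top"
      by (rule seeking_tendsto[OF L_sym L_psd F_monotone F_lipschitz mu_pos a eq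
            zeta_ode u_eq z_ode l_argmin])
  qed
  have zeta_inv: "\<zeta> t \<in> X" if a: "\<alpha> r > \<theta>\<^sup>2 / (4 * \<mu>)" and init: "\<zeta> 0 \<in> X" and t: "0 \<le> t" for t
    unfolding X_eq
  proof (rule feasible_lag_invariant[OF zeta_ode _ init[unfolded X_eq] t])
    fix s :: real and k assume s: "0 \<le> s" and k: "H $ k \<le> (G *v \<zeta> s) $ k"
    have "(G *v u s) $ k \<le> - \<alpha> r * ((G *v \<zeta> s) $ k - H $ k)"
      using seeking_barrier[OF graph(1) l_argmin[OF s, unfolded Gd_def L_def Hs_def]
          u_eq[OF s, unfolded Gd_def]] unfolding H_def .
    also have "\<dots> \<le> 0" using a_nonneg[OF a] k by simp
    finally show "(G *v u s) $ k \<le> 0" .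
  qed
  show "\<exists>zs. (\<forall>y. transformed_v_GNE own J Z (r - 1) y \<longleftrightarrow> y = zs) \<and> (\<zeta> \<longlongrightarrow> zs) at_top"
    if "\<alpha> r > \<theta>\<^sup>2 / (4 * \<mu>)"
    using zs_transformed zeta_lim[OF that] by blast
  show "\<forall>t\<ge>0. \<zeta> t \<in> Z" if "\<alpha> r > \<theta>\<^sup>2 / (4 * \<mu>)" "\<zeta> 0 \<in> Z"
    using zeta_inv[OF that(1)] that(2) by (simp add: X_eq)
  show "ISS {1..r - 1} (derivative_field \<alpha> (r - 1) ::
      nat \<Rightarrow> (nat \<Rightarrow> real ^ 'n) \<Rightarrow> real ^ 'n \<Rightarrow> real ^ 'n)"
    if "\<forall>k\<in>{1..r - 1}. \<alpha> k > 0"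
    by (rule ISS_derivative_field[OF that])
  define \<xi> where "\<xi> k t = zeta_coord \<alpha> k (x t) (\<lambda>j. xd j t)" for k t
  have \<xi>_q: "\<xi> q t = \<zeta> t" if "0 \<le> t" for t
    using x_eq[OF that] by (simp add: \<xi>_def zeta_coord_def q_def)
  have \<xi>_0: "\<xi> 0 = x" by (simp add: \<xi>_def zeta_coord_def fun_eq_iff)
  {
    assume *: "\<alpha> r > \<theta>\<^sup>2 / (4 * \<mu>) \<and> (\<forall>k\<in>{1..r - 1}. \<alpha> k > 0)"
    then have a: "\<alpha> r > \<theta>\<^sup>2 / (4 * \<mu>)" and pos: "\<forall>k\<in>{1..q}. 0 < \<alpha> k" by (auto simp: q_def)
    have \<xi>_ode: "(\<xi> k has_vector_derivative \<alpha> (Suc k) *\<^sub>R (\<xi> (Suc k) t - \<xi> k t)) (at t within {0..})"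
      if "k < q" "0 \<le> t" for k t
      unfolding \<xi>_def
      by (rule zeta_coord_derivative[OF pos zeta_ode xd_ode[folded q_def] x_eq[folded q_def] that])
    \<comment> \<open>Descent from \<open>\<zeta>\<close> to \<open>x\<close>. Continuity is carried
      along because \<open>lag_tendsto\<close> bounds its input on a compact interval.\<close>
    have \<xi>_lim: "(\<xi> (q - n) \<longlongrightarrow> zs) at_top \<and> continuous_on {0..} (\<xi> (q - n))" if "n \<le> q" for n
      using that
    proof (induction n)
      case 0
      have "\<forall>\<^sub>F t in at_top. \<zeta> t = \<xi> q t"
        using eventually_ge_at_top[of 0] by eventually_elim (simp add: \<xi>_q)
      then have "(\<xi> q \<longlongrightarrow> zs) at_top"
        using zeta_lim[OF a] by (rule Lim_transform_eventually[rotated])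
      moreover have "continuous_on {0..} \<zeta>"
        by (rule continuous_on_vector_derivative[OF zeta_ode]) simp
      then have "continuous_on {0..} (\<xi> q)"
        using continuous_on_cong[of "{0..}" "{0..}" "\<xi> q" \<zeta>] \<xi>_q by auto
      ultimately show ?case by simp
    next
      case (Suc n)
      define k where "k = q - Suc n"
      have k: "k < q" "Suc k = q - n" using Suc.prems by (auto simp: k_def)
      then have "0 < \<alpha> (Suc k)" using pos by auto
      moreover have "(\<xi> (Suc k) \<longlongrightarrow> zs) at_top" "continuous_on {0..} (\<xi> (Suc k))"
        using Suc k by auto
      ultimately have "(\<xi> k \<longlongrightarrow> zs) at_top"
        by (intro lag_tendsto[OF \<xi>_ode[OF k(1)]])
      moreover have "continuous_on {0..} (\<xi> k)"
        by (rule continuous_on_vector_derivative[OF \<xi>_ode[OF k(1)]]) simp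
      ultimately show ?case by (simp add: k_def)
    qed
    have "(x \<longlongrightarrow> zs) at_top" using \<xi>_lim[of q] by (simp add: \<xi>_0)
    then show "\<exists>xs. (\<forall>y. v_GNE own J X y \<longleftrightarrow> y = xs) \<and> (x \<longlongrightarrow> xs) at_top"
      using zs_GNE by blast
    assume init: "\<forall>k\<in>{1..r - 1}. zeta_coord \<alpha> k (x 0) (\<lambda>j. xd j 0) \<in> X"
    \<comment> \<open>Stage 0 is the position, covered by \<open>x_init\<close>; the others are
      covered by \<open>init\<close>.\<close>
    have \<xi>_init: "\<xi> k 0 \<in> X" if "k \<le> q" for k
      using that init x_init \<xi>_0 by (cases "k = 0") (auto simp: \<xi>_def q_def)
    \<comment> \<open>Where \<open>\<xi> k\<close> meets or exceeds a constraint, its target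
      \<open>\<xi> (Suc k)\<close> still satisfies it, so the lag does not push outwards.\<close>
    have \<xi>_inv: "\<forall>t\<ge>0. \<xi> (q - n) t \<in> X" if "n \<le> q" for n
      using that
    proof (induction n)
      case 0
      then show ?case using zeta_inv[OF a] \<xi>_init[of q] \<xi>_q by simp
    next
      case (Suc n)
      define k where "k = q - Suc n"
      have k: "k < q" "Suc k = q - n" using Suc.prems by (auto simp: k_def)
      then have \<alpha>_pos: "0 < \<alpha> (Suc k)" using pos by auto
      have next_inv: "(G *v \<xi> (Suc k) t) $ j \<le> H $ j" if "0 \<le> t" for t j
        using Suc k that by (simp add: X_eq feasible_iff)
      have "\<xi> k t \<in> feasible_set G H" if "0 \<le> t" for t
      proof (rule feasible_lag_invariant[OF \<xi>_ode[OF k(1)] _ _ that])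
        show "\<xi> k 0 \<in> feasible_set G H" using \<xi>_init[of k] k by (simp add: X_eq)
        fix s :: real and j assume s: "0 \<le> s" "H $ j \<le> (G *v \<xi> k s) $ j"
        then have "(G *v \<xi> (Suc k) s) $ j - (G *v \<xi> k s) $ j \<le> 0"
          using next_inv[OF s(1), of j] by simp
        then show "(G *v (\<alpha> (Suc k) *\<^sub>R (\<xi> (Suc k) s - \<xi> k s))) $ j \<le> 0"
          using \<alpha>_pos by (simp add: matrix_vector_mult_scaleR matrix_vector_mult_diff_distrib
              mult_nonneg_nonpos)
      qed
      then show ?case by (simp add: X_eq k_def)
    qed
    show "\<forall>t\<ge>0. x t \<in> X" using \<xi>_inv[of q] by (simp add: \<xi>_0)
  }
qed

end
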